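(* Let $G$ be a Lie group with Lie algebra $\mathfrak{g}$, let $g$ be a left invariant Riemannian metric on $G$ and $X$ a left invariant vector field on $G$. Let $F(x,y)=\dfrac{g(y,y)}{g(X(x),y)}$ be the corresponding left invariant Kropina metric, and suppose that $F$ is of Berwald type and that the Chern connection of $F$ coincides with the Levi-Civita connection of $g$. Let $(P,y)$ be a flag in $\mathfrak{g}$ with $g(X,y)>0$ such that $\{v,y\}$ is an orthonormal basis of $P$ with respect to $g$. Then the flag curvature of $F$ satisfies $$K^F(P,y)=\frac{1}{F^4\,g(X,v)^2+F^2}\,K^g(P),$$ where $F=F(y)$ and $K^g$ denotes the sectional curvature of the Riemannian metric $g$.
   Context: The Kropina metric $F=g(y,y)/g(X,y)$ is considered on the open cone of tangent vectors $y$ with $g(X,y)>0$, where it is smooth, positive, positively homogeneous of degree one in $y$, and has positive definite $\left(\frac12\frac{\partial^2F^2}{\partial y^i\partial y^j}\right)$. $F$ is left invariant, i.e. $F(x,y)=F(e,dl_{x^{-1}}y)$, and left invariant objects are identified with their values on $\mathfrak{g}=T_eG$. $F$ is of Berwald type if, in standard local coordinates, the Christoffel symbols $\Gamma^i_{jk}$ of its Chern connection do not depend on $y$. A flag $(P,y)$ consists of a 2-dimensional subspace $P$ and a nonzero vector $y\in P$. The flag curvature is $$K^F(P,y)=\frac{g_y(R_y(u),u)}{g_y(y,y)g_y(u,u)-g_y(y,u)^2},$$ where $P=\mathrm{span}\{u,y\}$, $g_y(u,v)=\frac12\frac{\partial^2}{\partial s\,\partial t}F^2(y+su+tv)\big|_{s=t=0}$,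 $R_y(u)=R(u,y)y=\nabla_u\nabla_yy-\nabla_y\nabla_uy-\nabla_{[u,y]}y$ and $\nabla$ is the Chern connection of $F$. *)

theory Defs
  imports "HOL-Analysis.Analysis" "HOL-Algebra.Group"
begin

section \<open>Smooth manifolds and Lie groups\<close>

text \<open>\<open>C\<^sup>k\<close> and \<open>C\<^sup>\<infinity>\<close> maps on open subsets of Euclidean spaces.\<close>

primrec Ck_on :: "nat \<Rightarrow> 'a::euclidean_space set \<Rightarrow> ('a \<Rightarrow> 'b::real_normed_vector) \<Rightarrow> bool" where
  "Ck_on 0 S f \<longleftrightarrow> continuous_on S f"
| "Ck_on (Suc k) S f \<longleftrightarrow> (\<forall>x\<in>S. f differentiable (at x)) \<and>
     (\<forall>v. Ck_on k S (\<lambda>x. frechet_derivative f (at x) v))"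

definition smooth_on :: "'a::euclidean_space set \<Rightarrow> ('a \<Rightarrow> 'b::real_normed_vector) \<Rightarrow> bool" where
  "smooth_on S f \<longleftrightarrow> (\<forall>k. Ck_on k S f)"

type_synonym ('a, 'n) chart = "'a set \<times> ('a \<Rightarrow> real ^ 'n)"

abbreviation chart_dom :: "('a, 'n) chart \<Rightarrow> 'a set" where
  "chart_dom c \<equiv> fst c"

abbreviation coords :: "('a, 'n) chart \<Rightarrow> 'a \<Rightarrow> real ^ 'n" where
  "coords c \<equiv> snd c"

abbreviation chart_img :: "('a, 'n) chart \<Rightarrow> (real ^ 'n) set" where
  "chart_img c \<equiv> coords c ` chart_dom c"

definition point_of :: "('a, 'n) chart \<Rightarrow> real ^ 'n \<Rightarrow> 'a" where
  "point_of c = inv_into (chart_dom c) (coords c)"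

definition is_chart :: "'a topology \<Rightarrow> ('a, 'n::finite) chart \<Rightarrow> bool" where
  "is_chart T c \<longleftrightarrow> openin T (chart_dom c) \<and> open (chart_img c) \<and>
     homeomorphic_map (subtopology T (chart_dom c)) (top_of_set (chart_img c)) (coords c)"

text \<open>The atlas is not required to be maximal.\<close>

locale smooth_manifold =
  fixes T :: "'a topology" and A :: "('a, 'n::finite) chart set"
  assumes Hausdorff: "Hausdorff_space T"
    and second_countable: "second_countable T"
    and charts: "c \<in> A \<Longrightarrow> is_chart T c"
    and covering: "(\<Union>c\<in>A. chart_dom c) = topspace T"
    and compatible: "c \<in> A \<Longrightarrow> d \<in> A \<Longrightarrow>
      smooth_on (coords c ` (chart_dom c \<inter> chart_dom d)) (\<lambda>a. coords d (point_of c a))"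

locale lie_group = group G + smooth_manifold T A
  for G :: "('a, 'm) monoid_scheme" (structure)
    and T :: "'a topology" and A :: "('a, 'n::finite) chart set" +
  assumes topspace_eq: "topspace T = carrier G"
    and continuous_mult: "continuous_map (prod_topology T T) T (\<lambda>(x, y). x \<otimes> y)"
    and continuous_inv: "continuous_map T T (\<lambda>x. inv x)"
    and smooth_mult: "c \<in> A \<Longrightarrow> d \<in> A \<Longrightarrow> e \<in> A \<Longrightarrow>
      smooth_on {(a, b). a \<in> chart_img c \<and> b \<in> chart_img d \<and>
                   point_of c a \<otimes> point_of d b \<in> chart_dom e}
        (\<lambda>(a, b). coords e (point_of c a \<otimes> point_of d b))"
    and smooth_inv: "c \<in> A \<Longrightarrow> d \<in> A \<Longrightarrow>
      smooth_on {a \<in> chart_img c. inv (point_of c a) \<in> chart_dom d}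
        (\<lambda>a. coords d (inv (point_of c a)))"

section \<open>Vector fields and Riemannian metrics\<close>

text \<open>A tangent vector at \<open>p\<close> is given by its components with respect to a chart around \<open>p\<close>.
  A tensor field is a family that assigns to a chart \<open>c\<close> and a point \<open>p\<close> of its domain the
  components in \<open>c\<close>, subject to the usual transformation law under change of charts;
  values at points outside the domain of \<open>c\<close> are irrelevant.\<close>

type_synonym ('a, 'n) vfield = "('a, 'n) chart \<Rightarrow> 'a \<Rightarrow> real ^ 'n"
type_synonym ('a, 'n) metric_field = "('a, 'n) chart \<Rightarrow> 'a \<Rightarrow> real ^ 'n \<Rightarrow> real ^ 'n \<Rightarrow> real"
type_synonym ('a, 'n) finsler_fun = "('a, 'n) chart \<Rightarrow> 'a \<Rightarrow> real ^ 'n \<Rightarrow> real"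

text \<open>The differential at \<open>p\<close> of a map \<open>f\<close>, in components with respect to a chart \<open>c\<close> at \<open>p\<close>
  and a chart \<open>d\<close> at \<open>f p\<close>. For \<open>f = id\<close> it is the change of components from \<open>c\<close> to \<open>d\<close>.\<close>

definition tangent_map ::
    "('a, 'n::finite) chart \<Rightarrow> ('a, 'n) chart \<Rightarrow> ('a \<Rightarrow> 'a) \<Rightarrow> 'a \<Rightarrow> real ^ 'n \<Rightarrow> real ^ 'n" where
  "tangent_map c d f p = frechet_derivative (\<lambda>a. coords d (f (point_of c a))) (at (coords c p))"

definition vector_field :: "('a, 'n::finite) chart set \<Rightarrow> ('a, 'n) vfield \<Rightarrow> bool" where
  "vector_field A X \<longleftrightarrow>
     (\<forall>c\<in>A. smooth_on (chart_img c) (\<lambda>a. X c (point_of c a))) \<and>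
     (\<forall>c\<in>A. \<forall>d\<in>A. \<forall>p \<in> chart_dom c \<inter> chart_dom d. X d p = tangent_map c d id p (X c p))"

definition riemannian_metric :: "('a, 'n::finite) chart set \<Rightarrow> ('a, 'n) metric_field \<Rightarrow> bool" where
  "riemannian_metric A g \<longleftrightarrow>
     (\<forall>c\<in>A. \<forall>p\<in>chart_dom c. bilinear (g c p) \<and> (\<forall>u v. g c p u v = g c p v u) \<and>
        (\<forall>u. u \<noteq> 0 \<longrightarrow> g c p u u > 0)) \<and>
     (\<forall>c\<in>A. \<forall>u v. smooth_on (chart_img c) (\<lambda>a. g c (point_of c a) u v)) \<and>
     (\<forall>c\<in>A. \<forall>d\<in>A. \<forall>p \<in> chart_dom c \<inter> chart_dom d. \<forall>u v.
        g d p (tangent_map c d id p u) (tangent_map c d id p v) = g c p u v)"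

definition left_invariant_vfield ::
    "('a, 'm) monoid_scheme \<Rightarrow> ('a, 'n::finite) chart set \<Rightarrow> ('a, 'n) vfield \<Rightarrow> bool" where
  "left_invariant_vfield G A X \<longleftrightarrow>
     (\<forall>x\<in>carrier G. \<forall>c\<in>A. \<forall>d\<in>A. \<forall>p\<in>chart_dom c. x \<otimes>\<^bsub>G\<^esub> p \<in> chart_dom d \<longrightarrow>
        X d (x \<otimes>\<^bsub>G\<^esub> p) = tangent_map c d (\<lambda>z. x \<otimes>\<^bsub>G\<^esub> z) p (X c p))"

definition left_invariant_metric ::
    "('a, 'm) monoid_scheme \<Rightarrow> ('a, 'n::finite) chart set \<Rightarrow> ('a, 'n) metric_field \<Rightarrow> bool" where
  "left_invariant_metric G A g \<longleftrightarrow>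
     (\<forall>x\<in>carrier G. \<forall>c\<in>A. \<forall>d\<in>A. \<forall>p\<in>chart_dom c. x \<otimes>\<^bsub>G\<^esub> p \<in> chart_dom d \<longrightarrow>
        (\<forall>u v. g d (x \<otimes>\<^bsub>G\<^esub> p) (tangent_map c d (\<lambda>z. x \<otimes>\<^bsub>G\<^esub> z) p u)
                                (tangent_map c d (\<lambda>z. x \<otimes>\<^bsub>G\<^esub> z) p v) = g c p u v))"

text \<open>A chart \<open>c\<close> at the identity identifies the Lie algebra \<open>T\<^sub>eG\<close> with \<open>real ^ 'n\<close>. The following
  is the left invariant vector field with value \<open>u\<close> at the identity, as a function of the
  coordinates of \<open>c\<close>.\<close>

definition left_ext ::
    "('a, 'm) monoid_scheme \<Rightarrow> ('a, 'n::finite) chart \<Rightarrow> real ^ 'n \<Rightarrow> real ^ 'n \<Rightarrow> real ^ 'n" where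
  "left_ext G c u a = tangent_map c c (\<lambda>z. point_of c a \<otimes>\<^bsub>G\<^esub> z) \<one>\<^bsub>G\<^esub> u"

section \<open>Connections in local coordinates\<close>

definition pderiv_at :: "'n::finite \<Rightarrow> (real ^ 'n \<Rightarrow> real) \<Rightarrow> real ^ 'n \<Rightarrow> real" where
  "pderiv_at k f x = deriv (\<lambda>t. f (x + t *\<^sub>R axis k 1)) 0"

definition lie_bracket :: "(real ^ 'n::finite \<Rightarrow> real ^ 'n) \<Rightarrow> (real ^ 'n \<Rightarrow> real ^ 'n) \<Rightarrow>
    real ^ 'n \<Rightarrow> real ^ 'n" where
  "lie_bracket U W x =
     (\<chi> i. \<Sum>k\<in>UNIV. U x $ k * pderiv_at k (\<lambda>z. W z $ i) x - W x $ k * pderiv_at k (\<lambda>z. U z $ i) x)"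

text \<open>The Christoffel formula
  \<open>1/2 h\<^sup>i\<^sup>l (D\<^sub>k h\<^sub>l\<^sub>j + D\<^sub>j h\<^sub>l\<^sub>k - D\<^sub>l h\<^sub>j\<^sub>k)\<close>, with \<open>D l j k\<close> standing for \<open>D\<^sub>k h\<^sub>l\<^sub>j\<close>.\<close>

definition christoffel :: "real ^ 'n ^ 'n \<Rightarrow> ('n::finite \<Rightarrow> 'n \<Rightarrow> 'n \<Rightarrow> real) \<Rightarrow>
    'n \<Rightarrow> 'n \<Rightarrow> 'n \<Rightarrow> real" where
  "christoffel h D i j k =
     (1/2) * (\<Sum>l\<in>UNIV. matrix_inv h $ i $ l * (D l j k + D l k j - D j k l))"

definition levi_civita :: "(real ^ 'n::finite \<Rightarrow> real ^ 'n ^ 'n) \<Rightarrow> real ^ 'n \<Rightarrow>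
    'n \<Rightarrow> 'n \<Rightarrow> 'n \<Rightarrow> real" where
  "levi_civita h x = christoffel (h x) (\<lambda>l j k. pderiv_at k (\<lambda>z. h z $ l $ j) x)"

definition affine_cov :: "(real ^ 'n::finite \<Rightarrow> 'n \<Rightarrow> 'n \<Rightarrow> 'n \<Rightarrow> real) \<Rightarrow>
    (real ^ 'n \<Rightarrow> real ^ 'n) \<Rightarrow> (real ^ 'n \<Rightarrow> real ^ 'n) \<Rightarrow> real ^ 'n \<Rightarrow> real ^ 'n" where
  "affine_cov \<Gamma> U W x =
     (\<chi> i. (\<Sum>k\<in>UNIV. U x $ k * pderiv_at k (\<lambda>z. W z $ i) x) +
           (\<Sum>j\<in>UNIV. \<Sum>k\<in>UNIV. \<Gamma> x i j k * U x $ j * W x $ k))"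

definition affine_curv :: "(real ^ 'n::finite \<Rightarrow> 'n \<Rightarrow> 'n \<Rightarrow> 'n \<Rightarrow> real) \<Rightarrow>
    (real ^ 'n \<Rightarrow> real ^ 'n) \<Rightarrow> (real ^ 'n \<Rightarrow> real ^ 'n) \<Rightarrow> (real ^ 'n \<Rightarrow> real ^ 'n) \<Rightarrow>
    real ^ 'n \<Rightarrow> real ^ 'n" where
  "affine_curv \<Gamma> U V W x =
     affine_cov \<Gamma> U (affine_cov \<Gamma> V W) x - affine_cov \<Gamma> V (affine_cov \<Gamma> U W) x
     - affine_cov \<Gamma> (lie_bracket U V) W x"

section \<open>Finsler geometry in local coordinates\<close>

text \<open>Below, \<open>L x y\<close> is the expression of a (conic) Finsler metric in the standard
  coordinates of the tangent bundle induced by a chart.\<close>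

definition fundamental_tensor ::
    "(real ^ 'n::finite \<Rightarrow> real) \<Rightarrow> real ^ 'n \<Rightarrow> real ^ 'n \<Rightarrow> real ^ 'n \<Rightarrow> real" where
  "fundamental_tensor f y u v =
     (1/2) * deriv (\<lambda>s. deriv (\<lambda>t. (f (y + s *\<^sub>R u + t *\<^sub>R v))\<^sup>2) 0) 0"

definition fund_matrix ::
    "(real ^ 'n::finite \<Rightarrow> real ^ 'n \<Rightarrow> real) \<Rightarrow> real ^ 'n \<Rightarrow> real ^ 'n \<Rightarrow> real ^ 'n ^ 'n" where
  "fund_matrix L x y = (\<chi> i j. fundamental_tensor (L x) y (axis i 1) (axis j 1))"

text \<open>The formal Christoffel symbols \<open>\<gamma>\<^sup>i\<^sub>j\<^sub>k\<close>, using the \<open>x\<close>-derivatives of \<open>g\<^sub>i\<^sub>j(x, y)\<close>.\<close>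

definition formal_christoffel :: "(real ^ 'n::finite \<Rightarrow> real ^ 'n \<Rightarrow> real) \<Rightarrow>
    real ^ 'n \<Rightarrow> real ^ 'n \<Rightarrow> 'n \<Rightarrow> 'n \<Rightarrow> 'n \<Rightarrow> real" where
  "formal_christoffel L x y = levi_civita (\<lambda>z. fund_matrix L z y) x"

text \<open>The Cartan tensor \<open>C\<^sup>i\<^sub>j\<^sub>k = 1/2 g\<^sup>i\<^sup>l \<partial>g\<^sub>l\<^sub>j/\<partial>y\<^sup>k\<close>.\<close>

definition cartan :: "(real ^ 'n::finite \<Rightarrow> real ^ 'n \<Rightarrow> real) \<Rightarrow>
    real ^ 'n \<Rightarrow> real ^ 'n \<Rightarrow> 'n \<Rightarrow> 'n \<Rightarrow> 'n \<Rightarrow> real" where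
  "cartan L x y i j k = (\<Sum>l\<in>UNIV. matrix_inv (fund_matrix L x y) $ i $ l *
     ((1/2) * pderiv_at k (\<lambda>w. fund_matrix L x w $ l $ j) y))"

text \<open>The nonlinear connection \<open>N\<^sup>i\<^sub>j = \<gamma>\<^sup>i\<^sub>j\<^sub>k y\<^sup>k - C\<^sup>i\<^sub>j\<^sub>k \<gamma>\<^sup>k\<^sub>r\<^sub>s y\<^sup>r y\<^sup>s\<close> and the derivation
  \<open>\<delta>/\<delta>x\<^sup>k = \<partial>/\<partial>x\<^sup>k - N\<^sup>m\<^sub>k \<partial>/\<partial>y\<^sup>m\<close>.\<close>

definition nonlinear_connection :: "(real ^ 'n::finite \<Rightarrow> real ^ 'n \<Rightarrow> real) \<Rightarrow>
    real ^ 'n \<Rightarrow> real ^ 'n \<Rightarrow> 'n \<Rightarrow> 'n \<Rightarrow> real" where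
  "nonlinear_connection L x y i j =
     (\<Sum>k\<in>UNIV. formal_christoffel L x y i j k * y $ k) -
     (\<Sum>k\<in>UNIV. \<Sum>r\<in>UNIV. \<Sum>s\<in>UNIV.
        cartan L x y i j k * formal_christoffel L x y k r s * y $ r * y $ s)"

definition horizontal_deriv :: "(real ^ 'n::finite \<Rightarrow> real ^ 'n \<Rightarrow> real) \<Rightarrow> 'n \<Rightarrow>
    (real ^ 'n \<Rightarrow> real ^ 'n \<Rightarrow> real) \<Rightarrow> real ^ 'n \<Rightarrow> real ^ 'n \<Rightarrow> real" where
  "horizontal_deriv L k f x y =
     pderiv_at k (\<lambda>z. f z y) x - (\<Sum>m\<in>UNIV. nonlinear_connection L x y m k * pderiv_at m (f x) y)"

text \<open>The Chern connection
  \<open>\<Gamma>\<^sup>i\<^sub>j\<^sub>k = 1/2 g\<^sup>i\<^sup>l (\<delta>g\<^sub>l\<^sub>j/\<delta>x\<^sup>k + \<delta>g\<^sub>l\<^sub>k/\<delta>x\<^sup>j - \<delta>g\<^sub>j\<^sub>k/\<delta>x\<^sup>l)\<close>.\<close>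

definition chern :: "(real ^ 'n::finite \<Rightarrow> real ^ 'n \<Rightarrow> real) \<Rightarrow>
    real ^ 'n \<Rightarrow> real ^ 'n \<Rightarrow> 'n \<Rightarrow> 'n \<Rightarrow> 'n \<Rightarrow> real" where
  "chern L x y = christoffel (fund_matrix L x y)
     (\<lambda>l j k. horizontal_deriv L k (\<lambda>z w. fund_matrix L z w $ l $ j) x y)"

text \<open>The Chern connection is a linear connection on the pullback of the tangent bundle \<open>TM\<close> to
  (the cone in) \<open>TM\<close>. It acts on sections \<open>S x y\<close> of that bundle; a vector field \<open>U\<close> on the
  base acts through its horizontal lift.\<close>

definition chern_cov :: "(real ^ 'n::finite \<Rightarrow> real ^ 'n \<Rightarrow> real) \<Rightarrow> (real ^ 'n \<Rightarrow> real ^ 'n) \<Rightarrow>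
    (real ^ 'n \<Rightarrow> real ^ 'n \<Rightarrow> real ^ 'n) \<Rightarrow> real ^ 'n \<Rightarrow> real ^ 'n \<Rightarrow> real ^ 'n" where
  "chern_cov L U S x y =
     (\<chi> i. (\<Sum>k\<in>UNIV. U x $ k * horizontal_deriv L k (\<lambda>z w. S z w $ i) x y) +
           (\<Sum>j\<in>UNIV. \<Sum>k\<in>UNIV. chern L x y i j k * U x $ j * S x y $ k))"

text \<open>The bracket of two horizontal lifts differs from the horizontal lift of the bracket by a
  vertical field. It is omitted here, since the Chern connection has no vertical part and the
  field \<open>W\<close> does not depend on \<open>y\<close>. The result is the contraction of the hh-curvature of
  the Chern connection with \<open>U\<close>, \<open>V\<close>, \<open>W\<close>, and is tensorial in them.\<close>

definition chern_curv :: "(real ^ 'n::finite \<Rightarrow> real ^ 'n \<Rightarrow> real) \<Rightarrow>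
    (real ^ 'n \<Rightarrow> real ^ 'n) \<Rightarrow> (real ^ 'n \<Rightarrow> real ^ 'n) \<Rightarrow> (real ^ 'n \<Rightarrow> real ^ 'n) \<Rightarrow>
    real ^ 'n \<Rightarrow> real ^ 'n \<Rightarrow> real ^ 'n" where
  "chern_curv L U V W x y =
     chern_cov L U (chern_cov L V (\<lambda>z w. W z)) x y - chern_cov L V (chern_cov L U (\<lambda>z w. W z)) x y
     - chern_cov L (lie_bracket U V) (\<lambda>z w. W z) x y"

section \<open>Curvatures on a Lie group\<close>

definition local_finsler ::
    "('a, 'n) finsler_fun \<Rightarrow> ('a, 'n::finite) chart \<Rightarrow> real ^ 'n \<Rightarrow> real ^ 'n \<Rightarrow> real" where
  "local_finsler F c a = F c (point_of c a)"

definition local_metric ::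
    "('a, 'n) metric_field \<Rightarrow> ('a, 'n::finite) chart \<Rightarrow> real ^ 'n \<Rightarrow> real ^ 'n ^ 'n" where
  "local_metric g c a = (\<chi> i j. g c (point_of c a) (axis i 1) (axis j 1))"

text \<open>In both conditions \<open>D c p\<close> is the cone of admissible tangent vectors at \<open>p\<close>.\<close>

definition berwald_type :: "('a, 'n::finite) chart set \<Rightarrow> (('a, 'n) chart \<Rightarrow> 'a \<Rightarrow> (real ^ 'n) set) \<Rightarrow>
    ('a, 'n) finsler_fun \<Rightarrow> bool" where
  "berwald_type A D F \<longleftrightarrow> (\<forall>c\<in>A. \<forall>p\<in>chart_dom c. \<forall>y\<in>D c p. \<forall>y'\<in>D c p. \<forall>i j k.
     chern (local_finsler F c) (coords c p) y i j k = chern (local_finsler F c) (coords c p) y' i j k)"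

definition chern_eq_levi_civita :: "('a, 'n::finite) chart set \<Rightarrow>
    (('a, 'n) chart \<Rightarrow> 'a \<Rightarrow> (real ^ 'n) set) \<Rightarrow> ('a, 'n) finsler_fun \<Rightarrow> ('a, 'n) metric_field \<Rightarrow> bool" where
  "chern_eq_levi_civita A D F g \<longleftrightarrow> (\<forall>c\<in>A. \<forall>p\<in>chart_dom c. \<forall>y\<in>D c p. \<forall>i j k.
     chern (local_finsler F c) (coords c p) y i j k = levi_civita (local_metric g c) (coords c p) i j k)"

definition is_flag :: "(real ^ 'n::finite) set \<Rightarrow> real ^ 'n \<Rightarrow> bool" where
  "is_flag P y \<longleftrightarrow> subspace P \<and> dim P = 2 \<and> y \<in> P \<and> y \<noteq> 0"

text \<open>\<open>R\<^sub>y(u)\<close> for \<open>u\<close>, \<open>y\<close> in the Lie algebra, identified with left invariant vector fields.\<close>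

definition riemann_op :: "('a, 'm) monoid_scheme \<Rightarrow> ('a, 'n) finsler_fun \<Rightarrow> ('a, 'n::finite) chart \<Rightarrow>
    real ^ 'n \<Rightarrow> real ^ 'n \<Rightarrow> real ^ 'n" where
  "riemann_op G F c y u =
     chern_curv (local_finsler F c) (left_ext G c u) (left_ext G c y) (left_ext G c y)
       (coords c \<one>\<^bsub>G\<^esub>) y"

text \<open>The value does not depend on the choice of \<open>u\<close>.\<close>

definition flag_curvature :: "('a, 'm) monoid_scheme \<Rightarrow> ('a, 'n) finsler_fun \<Rightarrow>
    ('a, 'n::finite) chart \<Rightarrow> (real ^ 'n) set \<Rightarrow> real ^ 'n \<Rightarrow> real" where
  "flag_curvature G F c P y =
     (let u = (SOME u. span {u, y} = P);
          gy = fundamental_tensor (F c \<one>\<^bsub>G\<^esub>) y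
      in gy (riemann_op G F c y u) u / (gy y y * gy u u - (gy y u)\<^sup>2))"

definition sectional_curvature :: "('a, 'm) monoid_scheme \<Rightarrow> ('a, 'n) metric_field \<Rightarrow>
    ('a, 'n::finite) chart \<Rightarrow> (real ^ 'n) set \<Rightarrow> real" where
  "sectional_curvature G g c P =
     (let (u, w) = (SOME (u, w). span {u, w} = P);
          h = g c \<one>\<^bsub>G\<^esub>;
          R = affine_curv (levi_civita (local_metric g c))
                (left_ext G c u) (left_ext G c w) (left_ext G c w) (coords c \<one>\<^bsub>G\<^esub>)
      in h R u / (h u u * h w w - (h u w)\<^sup>2))"

section \<open>Kropina metrics\<close>

definition kropina :: "('a, 'n) metric_field \<Rightarrow> ('a, 'n) vfield \<Rightarrow> ('a, 'n::finite) finsler_fun" where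
  "kropina g X c p y = g c p y y / g c p (X c p) y"

definition kropina_cone :: "('a, 'n) metric_field \<Rightarrow> ('a, 'n) vfield \<Rightarrow>
    ('a, 'n::finite) chart \<Rightarrow> 'a \<Rightarrow> (real ^ 'n) set" where
  "kropina_cone g X c p = {y. g c p (X c p) y > 0}"

end

theory Submission
  imports Defs
begin

text \<open>
  Write \<open>h\<close> for the inner product \<open>g\<close> at the identity and \<open>\<beta> = h(X, \<sqdot>)\<close>, so that \<open>F = \<alpha>\<^sup>2/\<beta>\<close> with
  \<open>\<alpha>\<^sup>2(y) = h(y, y)\<close>.

  First, the curvature operator of \<open>F\<close> is the Riemannian one. The cone \<open>\<beta> > 0\<close> is open, and on it the
  symbols of the Chern connection are those of the Levi-Civita connection. Hence the sections that
  occur in the Chern curvature of fields on the base do not depend on \<open>y\<close> near the given vector, the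
  horizontal derivatives become partial derivatives, and the nonlinear connection disappears
  (\<open>chern_curv_eq_affine_curv\<close>).

  Second, \<open>\<beta>\<close> is parallel for \<open>g\<close> (\<open>b_parallel\<close>). The Christoffel formula, with its index lowered and
  contracted twice with \<open>y\<close>, says that \<open>F\<^sup>2\<close> is constant along the parallel transport of the Chern
  connection; the nonlinear connection drops out of this contraction because the Cartan tensor
  vanishes on \<open>y\<close>. The transport of the Levi-Civita connection also preserves \<open>\<alpha>\<^sup>2\<close>, hence it preserves
  \<open>\<beta> = \<alpha>\<^sup>2/F\<close> on an open cone, and then everywhere by linearity. A parallel covector annihilates the
  image of the curvature (\<open>parallel_covector_curvature_form\<close>), so \<open>r = R(v, y)y\<close> satisfies
  \<open>\<beta>(r) = 0\<close>; also \<open>h(r, y) = 0\<close>, since curvature operators are skew (\<open>curvature_form_skew\<close>).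

  What remains is algebra with the explicit fundamental tensor (\<open>kropina_tensor\<close>). Because of the two
  equations for \<open>r\<close> only one of its terms survives in \<open>g\<^sub>y(r, v) = 2 h(r, v)/\<beta>(y)\<^sup>2\<close>, while the Gram
  determinant of \<open>v\<close>, \<open>y\<close> with respect to \<open>g\<^sub>y\<close> is \<open>2 (\<beta>(v)\<^sup>2 + \<beta>(y)\<^sup>2)/\<beta>(y)\<^sup>6\<close>. The quotient is the stated
  multiple of \<open>h(r, v) = K\<^sup>g(P)\<close> (\<open>kropina_flag_quotient\<close>).

  Both curvatures are computed from an arbitrarily chosen basis of \<open>P\<close>, extended to left invariant
  fields. The values at the identity suffice because curvature is a tensor
  (\<open>affine_curv_eq_curvature_form\<close>), and the choice cancels because numerator and denominator scale
  with the same squared determinant (\<open>gram_determinant\<close>, \<open>sectional_quotient\<close>).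
\<close>

section \<open>Derivatives in coordinates\<close>

lemma has_derivative_vec_iff:
  fixes f :: "'a::real_normed_vector \<Rightarrow> real ^ 'n::finite"
  shows "(f has_derivative f') (at x) \<longleftrightarrow>
    (\<forall>i. ((\<lambda>z. f z $ i) has_derivative (\<lambda>m. f' m $ i)) (at x))"
proof -
  have B: "b \<in> Basis \<longleftrightarrow> (\<exists>i. b = axis i (1::real))" for b :: "real ^ 'n"
    by (auto simp: Basis_vec_def)
  show ?thesis
    unfolding has_derivative_componentwise_within [of f] Ball_def B
    by (auto simp: inner_axis)
qed

lemma linear_axis_sum:
  fixes v :: "real ^ 'n::finite"
  assumes "linear f"
  shows "(\<Sum>k\<in>UNIV. v $ k *\<^sub>R f (axis k 1)) = f v"
proof -
  have "f v = f (\<Sum>k\<in>UNIV. v $ k *\<^sub>R axis k 1)"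
    by (simp add: basis_expansion scalar_mult_eq_scaleR [symmetric])
  then show ?thesis
    by (simp add: linear_sum [OF assms] linear_cmul [OF assms])
qed

lemma bilinear_axis_sum:
  fixes u w :: "real ^ 'n::finite" and B :: "real ^ 'n \<Rightarrow> real ^ 'n \<Rightarrow> real"
  assumes "bilinear B"
  shows "(\<Sum>l\<in>UNIV. \<Sum>j\<in>UNIV. B (axis l 1) (axis j 1) * u $ l * w $ j) = B u w"
proof -
  have 1: "linear (\<lambda>u. B u w)" and 2: "linear (\<lambda>w. B u w)" for u w
    using assms by (auto simp: bilinear_def)
  have "B u w = (\<Sum>l\<in>UNIV. u $ l *\<^sub>R (\<Sum>j\<in>UNIV. w $ j *\<^sub>R B (axis l 1) (axis j 1)))"
    by (simp only: linear_axis_sum [OF 2] linear_axis_sum [OF 1])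
  then show ?thesis by (simp add: sum_distrib_left sum_distrib_right algebra_simps)
qed

lemma pderiv_at_eq:
  assumes "(f has_derivative f') (at x)"
  shows "pderiv_at k f x = f' (axis k 1)"
proof -
  have "((\<lambda>t. x + t *\<^sub>R axis k (1::real)) has_derivative (\<lambda>t. t *\<^sub>R axis k 1)) (at 0)"
    by (auto intro!: derivative_eq_intros)
  moreover have "(f has_derivative f') (at (x + 0 *\<^sub>R axis k (1::real)))"
    using assms by simp
  ultimately have "((\<lambda>t. f (x + t *\<^sub>R axis k 1)) has_derivative (\<lambda>t. f' (t *\<^sub>R axis k 1))) (at 0)"
    by (rule has_derivative_compose)
  then have "((\<lambda>t. f (x + t *\<^sub>R axis k 1)) has_field_derivative f' (axis k 1)) (at 0)"
    using linear_cmul [OF has_derivative_linear [OF assms]]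
    by (simp add: has_field_derivative_def mult_commute_abs)
  then show ?thesis by (simp add: pderiv_at_def DERIV_imp_deriv)
qed

lemma pderiv_at_cong:
  assumes "open N" "x \<in> N" "\<And>z. z \<in> N \<Longrightarrow> f z = g z"
  shows "pderiv_at k f x = pderiv_at k g x"
proof -
  have "((\<lambda>t. x + t *\<^sub>R axis k (1::real)) \<longlongrightarrow> x) (nhds 0)"
    by (rule tendsto_eq_intros filterlim_ident | simp)+
  then have "\<forall>\<^sub>F t in nhds 0. x + t *\<^sub>R axis k 1 \<in> N"
    using assms(1,2) by (rule topological_tendstoD)
  then have "\<forall>\<^sub>F t in nhds 0. f (x + t *\<^sub>R axis k 1) = g (x + t *\<^sub>R axis k 1)"
    by eventually_elim (rule assms(3))
  then show ?thesis unfolding pderiv_at_def by (intro deriv_cong_ev) auto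
qed

lemma pderiv_at_const [simp]: "pderiv_at k (\<lambda>z. a) x = 0"
  by (simp add: pderiv_at_def)

lemma sum_pderiv_at:
  assumes "(f has_derivative f') (at x)"
  shows "(\<Sum>k\<in>UNIV. v $ k * pderiv_at k f x) = f' v"
  using linear_axis_sum [OF has_derivative_linear [OF assms], of v]
  by (simp add: pderiv_at_eq [OF assms])

text \<open>The mean value theorem in the direction \<open>u\<close> turns the second difference into a first difference of
  the directional derivative \<open>f' _ u\<close>, which is governed by its differentiability at \<open>x\<close>.\<close>

lemma second_difference_tendsto:
  fixes f :: "'a::real_normed_vector \<Rightarrow> real"
  assumes N: "open N" "x \<in> N" and f: "\<And>z. z \<in> N \<Longrightarrow> (f has_derivative f' z) (at z)"
    and A: "((\<lambda>z. f' z u) has_derivative A) (at x)"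
  shows "((\<lambda>t. (f (x + t *\<^sub>R u + t *\<^sub>R v) - f (x + t *\<^sub>R u) - f (x + t *\<^sub>R v) + f x) / t\<^sup>2)
    \<longlongrightarrow> A v) (at_right 0)"
proof (rule tendstoI)
  fix e :: real assume e: "e > 0"
  \<comment> \<open>\<open>t * K\<close> bounds all displacements below; the summand 1 keeps \<open>K\<close> positive when \<open>u\<close> and \<open>v\<close> vanish.\<close>
  define K where "K = 2 * (norm u + norm v) + 1"
  have K: "K > 0" by (simp add: K_def add_nonneg_pos)
  from N obtain r where r: "r > 0" "ball x r \<subseteq> N" by (meson open_contains_ball)
  have "e / (2 * K) > 0" using e K by simp
  with A obtain d where d: "d > 0"
    "\<And>z. norm (z - x) < d \<Longrightarrow> norm (f' z u - f' x u - A (z - x)) \<le> e / (2 * K) * norm (z - x)"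
    unfolding has_derivative_at_alt by blast
  interpret A: linear A using A by (rule has_derivative_linear)
  have "dist ((f (x + t *\<^sub>R u + t *\<^sub>R v) - f (x + t *\<^sub>R u) - f (x + t *\<^sub>R v) + f x) / t\<^sup>2) (A v) < e"
    if t: "0 < t" "t < min r d / K" for t
  proof -
    have tK: "t * K < r" "t * K < d" using t K by (auto simp: field_simps)
    have small: "norm (s *\<^sub>R u + q *\<^sub>R v) \<le> t * (norm u + norm v)"
      "t * (norm u + norm v) < r" "t * (norm u + norm v) < d"
      if "0 \<le> s" "s \<le> t" "0 \<le> q" "q \<le> t" for s q
    proof -
      have "norm (s *\<^sub>R u + q *\<^sub>R v) \<le> s * norm u + q * norm v"
        using that norm_triangle_ineq [of "s *\<^sub>R u" "q *\<^sub>R v"] by simp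
      also have "\<dots> \<le> t * norm u + t * norm v"
        using that by (intro add_mono mult_right_mono) auto
      finally show "norm (s *\<^sub>R u + q *\<^sub>R v) \<le> t * (norm u + norm v)"
        by (simp add: algebra_simps)
      have "t * (norm u + norm v) \<le> t * K"
        using t by (intro mult_left_mono) (auto simp: K_def)
      then show "t * (norm u + norm v) < r" "t * (norm u + norm v) < d" using tK by auto
    qed
    have inN: "x + s *\<^sub>R u + q *\<^sub>R v \<in> N" if "0 \<le> s" "s \<le> t" "0 \<le> q" "q \<le> t" for s q
    proof -
      have "dist x (x + s *\<^sub>R u + q *\<^sub>R v) < r"
        using small [OF that] by (simp add: dist_norm norm_minus_commute add.assoc add.commute)
      then show ?thesis using r(2) by auto
    qed
    define \<phi> where "\<phi> s = f (x + s *\<^sub>R u + t *\<^sub>R v) - f (x + s *\<^sub>R u)" for s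
    define D where "D s = f' (x + s *\<^sub>R u + t *\<^sub>R v) u - f' (x + s *\<^sub>R u) u" for s
    have dphi: "(\<phi> has_real_derivative D s) (at s)" if s: "0 \<le> s" "s \<le> t" for s
    proof -
      have line: "((\<lambda>s. f (x + s *\<^sub>R u + q *\<^sub>R v)) has_derivative
          (\<lambda>h. f' (x + s *\<^sub>R u + q *\<^sub>R v) (h *\<^sub>R u))) (at s)" if "0 \<le> q" "q \<le> t" for q
        by (rule has_derivative_compose [where f = "\<lambda>s. x + s *\<^sub>R u + q *\<^sub>R v",
              OF _ f [OF inN [OF s that]]]) (auto intro!: derivative_eq_intros)
      have lin: "f' (x + s *\<^sub>R u + q *\<^sub>R v) (h *\<^sub>R u) = h * f' (x + s *\<^sub>R u + q *\<^sub>R v) u"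
        if "0 \<le> q" "q \<le> t" for q h
        using linear_cmul [OF has_derivative_linear [OF f [OF inN [OF s that]]]] by simp
      have "((\<lambda>s. f (x + s *\<^sub>R u + q *\<^sub>R v)) has_real_derivative f' (x + s *\<^sub>R u + q *\<^sub>R v) u) (at s)"
        if "0 \<le> q" "q \<le> t" for q
        using line [OF that] lin [OF that] by (simp add: has_field_derivative_def mult_commute_abs)
      from this [of t] this [of 0] show ?thesis
        unfolding \<phi>_def D_def using t by (auto intro!: derivative_eq_intros)
    qed
    obtain s where s: "0 < s" "s < t" "\<phi> t - \<phi> 0 = t * D s"
      using MVT2 [of 0 t \<phi> D] dphi t by auto
    have b1: "norm (f' (x + s *\<^sub>R u + t *\<^sub>R v) u - f' x u - A (s *\<^sub>R u + t *\<^sub>R v))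
        \<le> e / (2 * K) * (t * (norm u + norm v))"
    proof -
      have "norm (f' (x + s *\<^sub>R u + t *\<^sub>R v) u - f' x u - A (s *\<^sub>R u + t *\<^sub>R v))
          \<le> e / (2 * K) * norm (s *\<^sub>R u + t *\<^sub>R v)"
        using d(2) [of "x + s *\<^sub>R u + t *\<^sub>R v"] small [of s t] s by (simp add: add.assoc)
      also have "\<dots> \<le> e / (2 * K) * (t * (norm u + norm v))"
        using small [of s t] s e K by (intro mult_left_mono) auto
      finally show ?thesis .
    qed
    have b2: "norm (f' (x + s *\<^sub>R u) u - f' x u - A (s *\<^sub>R u))
        \<le> e / (2 * K) * (t * (norm u + norm v))"
    proof -
      have "norm (f' (x + s *\<^sub>R u) u - f' x u - A (s *\<^sub>R u)) \<le> e / (2 * K) * norm (s *\<^sub>R u)"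
        using d(2) [of "x + s *\<^sub>R u"] small [of s 0] s by simp
      also have "\<dots> \<le> e / (2 * K) * (t * (norm u + norm v))"
        using small [of s 0] s e K by (intro mult_left_mono) auto
      finally show ?thesis .
    qed
    have "A (s *\<^sub>R u + t *\<^sub>R v) = A (s *\<^sub>R u) + t * A v" by (simp add: A.add A.scaleR)
    then have "\<bar>D s - t * A v\<bar> \<le> 2 * (e / (2 * K) * (t * (norm u + norm v)))"
      using b1 b2 unfolding D_def real_norm_def by linarith
    also have "\<dots> = t * (e * ((norm u + norm v) / K))" using K by (simp add: field_simps)
    also have "\<dots> < t * e"
    proof -
      have "(norm u + norm v) / K < 1" using K by (simp add: K_def add_nonneg_pos)
      from mult_strict_left_mono [OF mult_strict_left_mono [OF this e] t(1)]
      show ?thesis by (simp only: mult_1_right)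
    qed
    finally have "\<bar>D s - t * A v\<bar> < t * e" .
    then have "\<bar>D s / t - A v\<bar> < e"
      using t by (simp add: field_simps abs_less_iff)
    moreover have "(f (x + t *\<^sub>R u + t *\<^sub>R v) - f (x + t *\<^sub>R u) - f (x + t *\<^sub>R v) + f x) / t\<^sup>2 = D s / t"
      using s(3) t by (simp add: \<phi>_def field_simps power2_eq_square)
    ultimately show ?thesis by (simp add: dist_real_def)
  qed
  moreover have "0 < min r d / K" using r d K by simp
  ultimately show "\<forall>\<^sub>F t in at_right 0.
      dist ((f (x + t *\<^sub>R u + t *\<^sub>R v) - f (x + t *\<^sub>R u) - f (x + t *\<^sub>R v) + f x) / t\<^sup>2) (A v) < e"
    unfolding eventually_at_right_field by blast
qed

text \<open>The second difference is symmetric in the two directions, so its two limits agree.\<close>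

lemma second_derivative_symmetric:
  fixes f :: "'a::real_normed_vector \<Rightarrow> real"
  assumes N: "open N" "x \<in> N" and f: "\<And>z. z \<in> N \<Longrightarrow> (f has_derivative f' z) (at z)"
    and A: "((\<lambda>z. f' z u) has_derivative A) (at x)"
    and B: "((\<lambda>z. f' z v) has_derivative B) (at x)"
  shows "A v = B u"
proof -
  have "x + t *\<^sub>R v + t *\<^sub>R u = x + t *\<^sub>R u + t *\<^sub>R v" for t by (simp add: algebra_simps)
  then have "((\<lambda>t. (f (x + t *\<^sub>R u + t *\<^sub>R v) - f (x + t *\<^sub>R u) - f (x + t *\<^sub>R v) + f x) / t\<^sup>2)
    \<longlongrightarrow> B u) (at_right 0)"
    using second_difference_tendsto [OF N f B, of u] by (simp add: algebra_simps)
  then show ?thesis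
    using second_difference_tendsto [OF N f A, of v] tendsto_unique trivial_limit_at_right_real
    by blast
qed

text \<open>The product rule for evaluating a varying linear map at a varying vector. On a finite-dimensional
  space it suffices to differentiate the linear maps pointwise, by expanding the vector in the standard
  basis.\<close>

lemma has_derivative_apply_linear:
  fixes Y :: "'a::real_normed_vector \<Rightarrow> real ^ 'n::finite"
    and F :: "'a \<Rightarrow> real ^ 'n \<Rightarrow> 'b::real_normed_vector"
  assumes N: "open N" "x \<in> N" and lin: "\<And>z. z \<in> N \<Longrightarrow> linear (F z)"
    and F: "\<And>v. ((\<lambda>z. F z v) has_derivative F' v) (at x)" and Y: "(Y has_derivative Y') (at x)"
  shows "((\<lambda>z. F z (Y z)) has_derivative (\<lambda>m. F' (Y x) m + F x (Y' m))) (at x)"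
proof -
  have on_N: "(\<Sum>k\<in>UNIV. v $ k *\<^sub>R F z (axis k 1)) = F z v" if "z \<in> N" for v z
    by (rule linear_axis_sum [OF lin [OF that]])
  have "((\<lambda>z. \<Sum>k\<in>UNIV. Y x $ k *\<^sub>R F z (axis k 1)) has_derivative
      (\<lambda>m. \<Sum>k\<in>UNIV. Y x $ k *\<^sub>R F' (axis k 1) m)) (at x)"
    by (auto intro!: derivative_eq_intros F)
  then have "((\<lambda>z. F z (Y x)) has_derivative (\<lambda>m. \<Sum>k\<in>UNIV. Y x $ k *\<^sub>R F' (axis k 1) m)) (at x)"
    by (rule has_derivative_transform_within_open [OF _ N]) (simp add: on_N)
  then have F'_eq: "F' (Y x) m = (\<Sum>k\<in>UNIV. Y x $ k *\<^sub>R F' (axis k 1) m)" for m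
    using has_derivative_unique [OF F] by metis
  have Yk: "((\<lambda>z. Y z $ k) has_derivative (\<lambda>m. Y' m $ k)) (at x)" for k
    using Y by (simp add: has_derivative_vec_iff)
  have "((\<lambda>z. \<Sum>k\<in>UNIV. Y z $ k *\<^sub>R F z (axis k 1)) has_derivative
      (\<lambda>m. \<Sum>k\<in>UNIV. Y x $ k *\<^sub>R F' (axis k 1) m + Y' m $ k *\<^sub>R F x (axis k 1))) (at x)"
    by (intro has_derivative_sum has_derivative_scaleR Yk F)
  then have "((\<lambda>z. F z (Y z)) has_derivative
      (\<lambda>m. \<Sum>k\<in>UNIV. Y x $ k *\<^sub>R F' (axis k 1) m + Y' m $ k *\<^sub>R F x (axis k 1))) (at x)"
    by (rule has_derivative_transform_within_open [OF _ N]) (simp add: on_N)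
  then show ?thesis by (simp add: sum.distrib F'_eq on_N [OF N(2)])
qed

section \<open>Connections and their curvature tensor\<close>

definition contract ::
    "('n \<Rightarrow> 'n \<Rightarrow> 'n \<Rightarrow> real) \<Rightarrow> real ^ 'n::finite \<Rightarrow> real ^ 'n \<Rightarrow> real ^ 'n" where
  "contract C u w = (\<chi> i. \<Sum>j\<in>UNIV. \<Sum>k\<in>UNIV. C i j k * u $ j * w $ k)"

lemma bilinear_contract: "bilinear (contract C)"
  by (auto simp: bilinear_def contract_def vec_eq_iff sum.distrib sum_distrib_left algebra_simps
      intro!: linearI)

lemma contract_commute:
  assumes "\<And>i j k. C i j k = C i k j"
  shows "contract C u w = contract C w u"
  unfolding contract_def vec_eq_iff
  by (subst sum.swap) (simp add: assms mult.commute mult.left_commute)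

lemma has_derivative_contract:
  assumes C: "\<And>i j k. ((\<lambda>z. C z i j k) has_derivative C' i j k) (at x)"
    and U: "(U has_derivative U') (at x)" and W: "(W has_derivative W') (at x)"
  shows "((\<lambda>z. contract (C z) (U z) (W z)) has_derivative
    (\<lambda>m. contract (\<lambda>i j k. C' i j k m) (U x) (W x) + contract (C x) (U' m) (W x)
       + contract (C x) (U x) (W' m))) (at x)"
  unfolding has_derivative_vec_iff
proof
  fix i
  have 1: "((\<lambda>z. U z $ j) has_derivative (\<lambda>m. U' m $ j)) (at x)"
    and 2: "((\<lambda>z. W z $ j) has_derivative (\<lambda>m. W' m $ j)) (at x)" for j
    using U W by (simp_all add: has_derivative_vec_iff)
  show "((\<lambda>z. contract (C z) (U z) (W z) $ i) has_derivative
    (\<lambda>m. (contract (\<lambda>i j k. C' i j k m) (U x) (W x) + contract (C x) (U' m) (W x)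
       + contract (C x) (U x) (W' m)) $ i)) (at x)"
    unfolding contract_def
    by (auto intro!: derivative_eq_intros C 1 2 simp: sum.distrib algebra_simps)
qed

lemma has_derivative_contract_const:
  assumes "\<And>i j k. ((\<lambda>z. C z i j k) has_derivative C' i j k) (at x)"
  shows "((\<lambda>z. contract (C z) u w) has_derivative (\<lambda>m. contract (\<lambda>i j k. C' i j k m) u w)) (at x)"
  using has_derivative_contract [OF assms has_derivative_const [of u] has_derivative_const [of w]]
  by (simp add: bilinear_lzero [OF bilinear_contract] bilinear_rzero [OF bilinear_contract])

lemma affine_cov_eq:
  assumes "(W has_derivative W') (at x)"
  shows "affine_cov \<Gamma> U W x = W' (U x) + contract (\<Gamma> x) (U x) (W x)"
proof -
  have "((\<lambda>z. W z $ i) has_derivative (\<lambda>m. W' m $ i)) (at x)" for i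
    using assms by (simp add: has_derivative_vec_iff)
  from sum_pderiv_at [OF this] show ?thesis
    by (simp add: affine_cov_def contract_def vec_eq_iff)
qed

lemma lie_bracket_eq:
  assumes "(U has_derivative U') (at x)" "(W has_derivative W') (at x)"
  shows "lie_bracket U W x = W' (U x) - U' (W x)"
proof -
  have 1: "((\<lambda>z. W z $ i) has_derivative (\<lambda>m. W' m $ i)) (at x)"
    and 2: "((\<lambda>z. U z $ i) has_derivative (\<lambda>m. U' m $ i)) (at x)" for i
    using assms by (simp_all add: has_derivative_vec_iff)
  show ?thesis
    by (simp add: lie_bracket_def vec_eq_iff sum_subtractf sum_pderiv_at [OF 1] sum_pderiv_at [OF 2])
qed

text \<open>The classical expression \<open>R(u, v)w\<close> of the curvature in terms of the symbols \<open>C\<close> of a connection at a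
  point and the derivatives \<open>C'\<close> of these symbols there.\<close>

definition curvature_form ::
    "('n \<Rightarrow> 'n \<Rightarrow> 'n \<Rightarrow> real) \<Rightarrow> ('n \<Rightarrow> 'n \<Rightarrow> 'n \<Rightarrow> real ^ 'n \<Rightarrow> real) \<Rightarrow>
      real ^ 'n::finite \<Rightarrow> real ^ 'n \<Rightarrow> real ^ 'n \<Rightarrow> real ^ 'n" where
  "curvature_form C C' u v w =
     contract (\<lambda>i j k. C' i j k u) v w - contract (\<lambda>i j k. C' i j k v) u w
     + contract C u (contract C v w) - contract C v (contract C u w)"

lemmas bilinear_arith = bilinear_ladd bilinear_radd bilinear_lmul bilinear_rmul bilinear_lsub
  bilinear_rsub bilinear_lneg bilinear_rneg

text \<open>Curvature is alternating and bilinear in its first two arguments, so a change of basis of a plane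
  multiplies it by the determinant.\<close>

lemma curvature_form_combination:
  assumes "\<And>i j k. linear (C' i j k)"
  shows "curvature_form C C' (a *\<^sub>R v + b *\<^sub>R y) (c *\<^sub>R v + d *\<^sub>R y) w =
    (a * d - b * c) *\<^sub>R curvature_form C C' v y w"
proof -
  have 1: "contract (\<lambda>i j k. C' i j k (p *\<^sub>R v + q *\<^sub>R y)) u w =
      p *\<^sub>R contract (\<lambda>i j k. C' i j k v) u w + q *\<^sub>R contract (\<lambda>i j k. C' i j k y) u w" for p q u w
    by (simp add: contract_def vec_eq_iff linear_add [OF assms] linear_cmul [OF assms]
        sum.distrib sum_distrib_left algebra_simps)
  show ?thesis
    unfolding curvature_form_def 1
    by (simp add: bilinear_arith [OF bilinear_contract] algebra_simps)
qed

lemma linear_curvature_form: "linear (curvature_form C C' u v)"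
  by (auto intro!: linearI simp: curvature_form_def bilinear_arith [OF bilinear_contract] algebra_simps)

text \<open>Tensoriality: the second derivatives of \<open>W\<close> cancel by symmetry, and the first derivatives of \<open>U\<close> and
  \<open>V\<close> cancel against the Lie bracket, so only values at \<open>x\<close> are left.\<close>

lemma affine_curv_eq_curvature_form:
  assumes N: "open N" "x \<in> N" and W: "\<And>z. z \<in> N \<Longrightarrow> (W has_derivative W' z) (at z)"
    and W2: "\<And>v. ((\<lambda>z. W' z v) has_derivative W'' v) (at x)"
    and U: "(U has_derivative U') (at x)" and V: "(V has_derivative V') (at x)"
    and \<Gamma>: "\<And>i j k. ((\<lambda>z. \<Gamma> z i j k) has_derivative \<Gamma>' i j k) (at x)"
  shows "affine_curv \<Gamma> U V W x = curvature_form (\<Gamma> x) \<Gamma>' (U x) (V x) (W x)"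
proof -
  have W''_sym: "W'' v u = W'' u v" for u v
  proof -
    have "W'' v u $ i = W'' u v $ i" for i
    proof (rule second_derivative_symmetric [where f = "\<lambda>z. W z $ i"
          and f' = "\<lambda>z m. W' z m $ i" and u = v and v = u, OF N])
      show "((\<lambda>z. W z $ i) has_derivative (\<lambda>m. W' z m $ i)) (at z)" if "z \<in> N" for z
        using W [OF that] by (simp add: has_derivative_vec_iff)
      show "((\<lambda>z. W' z v $ i) has_derivative (\<lambda>m. W'' v m $ i)) (at x)"
        "((\<lambda>z. W' z u $ i) has_derivative (\<lambda>m. W'' u m $ i)) (at x)"
        using W2 by (simp_all add: has_derivative_vec_iff)
    qed
    then show ?thesis by (simp add: vec_eq_iff)
  qed
  have cov: "(affine_cov \<Gamma> Q W has_derivative (\<lambda>m. W'' (Q x) m + W' x (Q' m)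
      + (contract (\<lambda>i j k. \<Gamma>' i j k m) (Q x) (W x) + contract (\<Gamma> x) (Q' m) (W x)
       + contract (\<Gamma> x) (Q x) (W' x m)))) (at x)"
    if Q: "(Q has_derivative Q') (at x)" for Q Q'
  proof -
    have "((\<lambda>z. W' z (Q z)) has_derivative (\<lambda>m. W'' (Q x) m + W' x (Q' m))) (at x)"
      using N has_derivative_linear [OF W] W2 Q by (rule has_derivative_apply_linear)
    from has_derivative_add [OF this has_derivative_contract [OF \<Gamma> Q W [OF N(2)]]]
    show ?thesis
      by (rule has_derivative_transform_within_open [OF _ N]) (simp add: affine_cov_eq [OF W])
  qed
  have lin: "linear (W' x)" by (rule has_derivative_linear [OF W [OF N(2)]])
  show ?thesis
    unfolding affine_curv_def affine_cov_eq [OF cov [OF V]] affine_cov_eq [OF cov [OF U]]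
      affine_cov_eq [OF W [OF N(2)]] lie_bracket_eq [OF U V] curvature_form_def
      linear_diff [OF lin] bilinear_lsub [OF bilinear_contract] bilinear_radd [OF bilinear_contract]
    by (simp add: W''_sym [of "V x" "U x"])
qed

text \<open>If \<open>h\<close> is parallel, then its first derivatives are expressed by \<open>h\<close> and the connection. Differentiating
  once more and antisymmetrizing gives zero on one side and the action of the curvature on \<open>h\<close> on the
  other.\<close>

lemma curvature_form_skew:
  fixes h :: "real ^ 'n::finite \<Rightarrow> real ^ 'n \<Rightarrow> real ^ 'n \<Rightarrow> real"
  assumes N: "open N" "x \<in> N" and bil: "\<And>z. z \<in> N \<Longrightarrow> bilinear (h z)"
    and h: "\<And>z u w. z \<in> N \<Longrightarrow> ((\<lambda>z. h z u w) has_derivative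
      (\<lambda>m. h z (contract (\<Gamma> z) m u) w + h z u (contract (\<Gamma> z) m w))) (at z)"
    and \<Gamma>: "\<And>i j k. ((\<lambda>z. \<Gamma> z i j k) has_derivative \<Gamma>' i j k) (at x)"
  shows "h x (curvature_form (\<Gamma> x) \<Gamma>' k l u) w + h x u (curvature_form (\<Gamma> x) \<Gamma>' k l w) = 0"
proof -
  let ?\<Gamma>' = "\<lambda>m. contract (\<lambda>i j k. \<Gamma>' i j k m)"
  note bx = bil [OF N(2)]
  have c: "((\<lambda>z. contract (\<Gamma> z) k u) has_derivative (\<lambda>m. ?\<Gamma>' m k u)) (at x)" for k u
    by (rule has_derivative_contract_const [OF \<Gamma>])
  have 1: "((\<lambda>z. h z (contract (\<Gamma> z) k u) w) has_derivative
      (\<lambda>m. (h x (contract (\<Gamma> x) m (contract (\<Gamma> x) k u)) w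
          + h x (contract (\<Gamma> x) k u) (contract (\<Gamma> x) m w)) + h x (?\<Gamma>' m k u) w)) (at x)" for k u w
    by (rule has_derivative_apply_linear [OF N, where F = "\<lambda>z v. h z v w"])
       (use bil in \<open>auto simp: bilinear_def intro: h N c\<close>)
  have 2: "((\<lambda>z. h z u (contract (\<Gamma> z) k w)) has_derivative
      (\<lambda>m. (h x (contract (\<Gamma> x) m u) (contract (\<Gamma> x) k w)
          + h x u (contract (\<Gamma> x) m (contract (\<Gamma> x) k w))) + h x u (?\<Gamma>' m k w))) (at x)" for k u w
    by (rule has_derivative_apply_linear [OF N, where F = "\<lambda>z v. h z u v"])
       (use bil in \<open>auto simp: bilinear_def intro: h N c\<close>)
  from second_derivative_symmetric [where f = "\<lambda>z. h z u w" and u = l and v = k, OF N h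
      has_derivative_add [OF 1 2] has_derivative_add [OF 1 2]]
  show ?thesis
    unfolding curvature_form_def bilinear_lsub [OF bx] bilinear_rsub [OF bx]
      bilinear_ladd [OF bx] bilinear_radd [OF bx]
    by simp
qed

text \<open>The same argument as for a parallel metric, applied to a field of covectors.\<close>

lemma parallel_covector_curvature_form:
  fixes b :: "real ^ 'n::finite \<Rightarrow> real ^ 'n \<Rightarrow> real"
  assumes N: "open N" "x \<in> N" and lin: "\<And>z. z \<in> N \<Longrightarrow> linear (b z)"
    and b: "\<And>z u. z \<in> N \<Longrightarrow> ((\<lambda>z. b z u) has_derivative (\<lambda>m. b z (contract (\<Gamma> z) m u))) (at z)"
    and \<Gamma>: "\<And>i j k. ((\<lambda>z. \<Gamma> z i j k) has_derivative \<Gamma>' i j k) (at x)"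
  shows "b x (curvature_form (\<Gamma> x) \<Gamma>' k l u) = 0"
proof -
  let ?\<Gamma>' = "\<lambda>m. contract (\<lambda>i j k. \<Gamma>' i j k m)"
  have c: "((\<lambda>z. contract (\<Gamma> z) k u) has_derivative (\<lambda>m. ?\<Gamma>' m k u)) (at x)" for k u
    by (rule has_derivative_contract_const [OF \<Gamma>])
  have 1: "((\<lambda>z. b z (contract (\<Gamma> z) k u)) has_derivative
      (\<lambda>m. b x (contract (\<Gamma> x) m (contract (\<Gamma> x) k u)) + b x (?\<Gamma>' m k u))) (at x)" for k u
    by (rule has_derivative_apply_linear [OF N lin b [OF N(2)] c])
  from second_derivative_symmetric [where f = "\<lambda>z. b z u" and u = l and v = k, OF N b 1 1]
  show ?thesis
    using N by (simp add: curvature_form_def linear_diff [OF lin] linear_add [OF lin])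
qed

section \<open>Christoffel symbols of a metric\<close>

lemma matrix_mul_matrix_inv:
  fixes H :: "real ^ 'n::finite ^ 'n"
  assumes "invertible H"
  shows "H ** matrix_inv H = mat 1"
  using someI_ex [of "\<lambda>B. H ** B = mat 1 \<and> B ** H = mat 1"] assms
  by (simp add: invertible_def matrix_inv_def)

lemma invertible_gram_matrix:
  fixes B :: "real ^ 'n::finite \<Rightarrow> real ^ 'n \<Rightarrow> real"
  assumes "bilinear B" and pos: "\<And>u. u \<noteq> 0 \<Longrightarrow> B u u > 0"
  shows "invertible (\<chi> i j. B (axis i 1) (axis j 1))" (is "invertible ?H")
proof -
  have "u \<bullet> (?H *v u) = B u u" for u
    by (simp add: bilinear_axis_sum [OF assms(1), of u u, symmetric] inner_vec_def matrix_vector_mult_def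
        sum_distrib_left algebra_simps)
  then have "u = 0" if "?H *v u = 0" for u
    using that pos [of u] by (metis inner_zero_right less_irrefl)
  then have "\<exists>H'. H' ** ?H = mat 1"
    by (simp add: matrix_left_invertible_ker)
  then show ?thesis by (simp add: invertible_left_inverse)
qed

lemma lower_christoffel:
  fixes H :: "real ^ 'n::finite ^ 'n"
  assumes "invertible H"
  shows "(\<Sum>i\<in>UNIV. H $ p $ i * christoffel H D i j k) = (1/2) * (D p j k + D p k j - D j k p)"
proof -
  have inv: "(\<Sum>i\<in>UNIV. H $ p $ i * matrix_inv H $ i $ l) = (if p = l then 1 else 0)" for l
    using matrix_mul_matrix_inv [OF assms]
    by (simp add: vec_eq_iff matrix_matrix_mult_def mat_def)
  have "(\<Sum>i\<in>UNIV. H $ p $ i * christoffel H D i j k) =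
      (\<Sum>i\<in>UNIV. \<Sum>l\<in>UNIV. (1/2) * ((H $ p $ i * matrix_inv H $ i $ l) * (D l j k + D l k j - D j k l)))"
    by (simp add: christoffel_def sum_distrib_left algebra_simps)
  also have "\<dots> = (1/2) * (\<Sum>l\<in>UNIV. (\<Sum>i\<in>UNIV. H $ p $ i * matrix_inv H $ i $ l)
      * (D l j k + D l k j - D j k l))"
    by (subst sum.swap) (simp only: sum_distrib_left sum_distrib_right)
  also have "\<dots> = (1/2) * (D p j k + D p k j - D j k p)"
    by (simp add: inv if_distrib if_distribR sum.delta cong: if_cong)
  finally show ?thesis .
qed

text \<open>The Christoffel formula is the solution of the compatibility equation between a connection and a
  metric whose derivatives are \<open>D\<close>. It is stated for an arbitrary array \<open>D\<close>, symmetric in its first two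
  indices, so that it covers partial derivatives of a Riemannian metric as well as horizontal
  derivatives of a fundamental tensor.\<close>

lemma christoffel_compatible:
  fixes B :: "real ^ 'n::finite \<Rightarrow> real ^ 'n \<Rightarrow> real"
  assumes B: "bilinear B" and pos: "\<And>u. u \<noteq> 0 \<Longrightarrow> B u u > 0" and B_sym: "\<And>u w. B u w = B w u"
    and D: "\<And>l j k. D l j k = D j l k"
    and C: "C = christoffel (\<chi> i j. B (axis i 1) (axis j 1)) D"
  shows "B u (contract C w m) + B w (contract C u m) =
    (\<Sum>l\<in>UNIV. \<Sum>j\<in>UNIV. \<Sum>k\<in>UNIV. D l j k * u $ l * w $ j * m $ k)"
proof -
  let ?B = "\<lambda>i j. B (axis i 1) (axis j 1)"
  have low: "(\<Sum>i\<in>UNIV. ?B p i * C i j k) = (1/2) * (D p j k + D p k j - D j k p)" for p j k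
    using lower_christoffel [OF invertible_gram_matrix [OF B pos], of p D j k] by (simp add: C)
  have expand: "B u (contract C w m) =
      (\<Sum>l\<in>UNIV. \<Sum>j\<in>UNIV. \<Sum>k\<in>UNIV. (1/2) * (D l j k + D l k j - D j k l) * u $ l * w $ j * m $ k)"
    for u w
  proof -
    have "B u (contract C w m) = (\<Sum>l\<in>UNIV. \<Sum>i\<in>UNIV. \<Sum>j\<in>UNIV. \<Sum>k\<in>UNIV.
        ?B l i * C i j k * u $ l * w $ j * m $ k)"
      unfolding bilinear_axis_sum [OF B, of u "contract C w m", symmetric]
      by (simp add: contract_def sum_distrib_left algebra_simps)
    also have "\<dots> = (\<Sum>l\<in>UNIV. \<Sum>j\<in>UNIV. \<Sum>i\<in>UNIV. \<Sum>k\<in>UNIV.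
        ?B l i * C i j k * u $ l * w $ j * m $ k)"
      by (intro sum.cong refl sum.swap)
    also have "\<dots> = (\<Sum>l\<in>UNIV. \<Sum>j\<in>UNIV. \<Sum>k\<in>UNIV. \<Sum>i\<in>UNIV.
        ?B l i * C i j k * u $ l * w $ j * m $ k)"
      by (intro sum.cong refl sum.swap)
    also have "\<dots> = (\<Sum>l\<in>UNIV. \<Sum>j\<in>UNIV. \<Sum>k\<in>UNIV.
        (\<Sum>i\<in>UNIV. ?B l i * C i j k) * u $ l * w $ j * m $ k)"
      by (simp only: sum_distrib_right)
    finally show ?thesis by (simp only: low)
  qed
  have swap: "B w (contract C u m) =
      (\<Sum>l\<in>UNIV. \<Sum>j\<in>UNIV. \<Sum>k\<in>UNIV. (1/2) * (D j l k + D j k l - D l k j) * w $ j * u $ l * m $ k)"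
    unfolding expand by (rule sum.swap)
  show ?thesis
    unfolding expand [of u w] swap sum.distrib [symmetric]
  proof (intro sum.cong refl)
    fix l j k
    show "(1/2) * (D l j k + D l k j - D j k l) * u $ l * w $ j * m $ k
        + (1/2) * (D j l k + D j k l - D l k j) * w $ j * u $ l * m $ k = D l j k * u $ l * w $ j * m $ k"
      by (simp add: D [of j l k] algebra_simps)
  qed
qed

lemma differentiable_prod:
  fixes f :: "'i \<Rightarrow> 'a::real_normed_vector \<Rightarrow> real"
  assumes "\<And>i. i \<in> I \<Longrightarrow> f i differentiable (at x)"
  shows "(\<lambda>z. \<Prod>i\<in>I. f i z) differentiable (at x)"
proof -
  have f': "(f i has_derivative frechet_derivative (f i) (at x)) (at x)" if "i \<in> I" for i
    using assms [OF that] by (simp add: frechet_derivative_works)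
  show ?thesis
    unfolding differentiable_def by (rule exI, rule has_derivative_prod, rule f')
qed

lemma differentiable_det:
  fixes M :: "'a::real_normed_vector \<Rightarrow> real ^ 'n::finite ^ 'n"
  assumes "\<And>i j. (\<lambda>z. M z $ i $ j) differentiable (at x)"
  shows "(\<lambda>z. det (M z)) differentiable (at x)"
  unfolding det_def
  by (rule differentiable_sum, simp)
    (rule ballI, rule differentiable_mult, rule differentiable_const, rule differentiable_prod, rule assms)

text \<open>Cramer's rule exhibits the entries of the inverse as quotients of polynomials in the entries of the
  matrix, which makes them differentiable.\<close>

lemma matrix_inv_cramer:
  fixes H :: "real ^ 'n::finite ^ 'n"
  assumes "invertible H"
  shows "matrix_inv H $ i $ j =
    det (\<chi> p q. if q = i then axis j 1 $ p else H $ p $ q) / det H"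
proof -
  have "H *v (matrix_inv H *v axis j 1) = axis j 1"
    by (simp add: matrix_vector_mul_assoc matrix_mul_matrix_inv [OF assms])
  moreover have "det H \<noteq> 0" using assms by (simp add: invertible_det_nz)
  ultimately have "matrix_inv H *v axis j 1 =
      (\<chi> k. det (\<chi> p q. if q = k then axis j 1 $ p else H $ p $ q) / det H)"
    using cramer by blast
  then have "(matrix_inv H *v axis j 1) $ i =
      det (\<chi> p q. if q = i then axis j 1 $ p else H $ p $ q) / det H" by simp
  then show ?thesis by (simp add: matrix_vector_mult_basis column_def)
qed

lemma differentiable_matrix_inv:
  fixes H :: "'a::real_normed_vector \<Rightarrow> real ^ 'n::finite ^ 'n"
  assumes N: "open N" "x \<in> N" and inv: "\<And>z. z \<in> N \<Longrightarrow> invertible (H z)"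
    and H: "\<And>p q. (\<lambda>z. H z $ p $ q) differentiable (at x)"
  shows "(\<lambda>z. matrix_inv (H z) $ i $ j) differentiable (at x)"
proof -
  have entry: "(\<lambda>z. (\<chi> p q. if q = i then axis j 1 $ p else H z $ p $ q) $ p $ q) differentiable (at x)"
    for p q by (cases "q = i") (simp_all add: H)
  have "(\<lambda>z. det (\<chi> p q. if q = i then axis j 1 $ p else H z $ p $ q) / det (H z)) differentiable (at x)"
    using inv [OF N(2)] by (intro differentiable_divide differentiable_det entry H)
      (simp add: invertible_det_nz)
  then obtain D where
    "((\<lambda>z. det (\<chi> p q. if q = i then axis j 1 $ p else H z $ p $ q) / det (H z)) has_derivative D) (at x)"
    unfolding differentiable_def by blast
  then have "((\<lambda>z. matrix_inv (H z) $ i $ j) has_derivative D) (at x)"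
    by (rule has_derivative_transform_within_open [OF _ N]) (simp add: matrix_inv_cramer inv)
  then show ?thesis unfolding differentiable_def by blast
qed

text \<open>A Riemannian metric in the coordinates of one chart, differentiable to the order that is needed to
  differentiate its Christoffel symbols once.\<close>

locale riemannian_chart =
  fixes N :: "(real ^ 'n::finite) set" and h :: "real ^ 'n \<Rightarrow> real ^ 'n \<Rightarrow> real ^ 'n \<Rightarrow> real"
  assumes open_N: "open N"
    and bil: "z \<in> N \<Longrightarrow> bilinear (h z)"
    and sym: "z \<in> N \<Longrightarrow> h z u w = h z w u"
    and pos: "z \<in> N \<Longrightarrow> u \<noteq> 0 \<Longrightarrow> h z u u > 0"
    and diff1: "z \<in> N \<Longrightarrow> (\<lambda>z. h z u w) differentiable (at z)"
    and diff2: "z \<in> N \<Longrightarrow>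
      (\<lambda>z. frechet_derivative (\<lambda>z. h z u w) (at z) v) differentiable (at z)"
begin

abbreviation gram :: "real ^ 'n \<Rightarrow> real ^ 'n ^ 'n" where
  "gram z \<equiv> \<chi> i j. h z (axis i 1) (axis j 1)"

abbreviation \<Gamma> :: "real ^ 'n \<Rightarrow> 'n \<Rightarrow> 'n \<Rightarrow> 'n \<Rightarrow> real" where
  "\<Gamma> \<equiv> levi_civita gram"

lemma h_has_derivative:
  assumes "z \<in> N"
  shows "((\<lambda>z. h z u w) has_derivative frechet_derivative (\<lambda>z. h z u w) (at z)) (at z)"
  using diff1 [OF assms] by (simp add: frechet_derivative_works)

lemma pderiv_at_sym:
  assumes "z \<in> N"
  shows "pderiv_at k (\<lambda>z. h z u w) z = pderiv_at k (\<lambda>z. h z w u) z"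
  by (rule pderiv_at_cong [OF open_N assms]) (rule sym)

lemma \<Gamma>_commute: "z \<in> N \<Longrightarrow> \<Gamma> z i j k = \<Gamma> z i k j"
  unfolding levi_civita_def christoffel_def
  using pderiv_at_sym [of z _ "axis j 1" "axis k 1"] by (simp add: add.commute)

lemma \<Gamma>_differentiable:
  assumes x: "x \<in> N"
  shows "(\<lambda>z. \<Gamma> z i j k) differentiable (at x)"
proof -
  have pd: "(\<lambda>z. pderiv_at k (\<lambda>z. h z u w) z) differentiable (at x)" for k u w
  proof -
    obtain D where "((\<lambda>z. frechet_derivative (\<lambda>z. h z u w) (at z) (axis k 1)) has_derivative D) (at x)"
      using diff2 [OF x] unfolding differentiable_def by blast
    then have "((\<lambda>z. pderiv_at k (\<lambda>z. h z u w) z) has_derivative D) (at x)"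
      by (rule has_derivative_transform_within_open [OF _ open_N x])
         (simp add: pderiv_at_eq [OF h_has_derivative])
    then show ?thesis unfolding differentiable_def by blast
  qed
  have inv: "(\<lambda>z. matrix_inv (gram z) $ i $ j) differentiable (at x)" for i j
    by (rule differentiable_matrix_inv [OF open_N x])
       (use bil pos x in \<open>auto intro!: invertible_gram_matrix diff1\<close>)
  show ?thesis
    unfolding levi_civita_def christoffel_def vec_lambda_beta
    by (intro differentiable_mult differentiable_const differentiable_sum ballI
        differentiable_add differentiable_diff pd inv) auto
qed

text \<open>The Levi-Civita connection is metric: the compatibility identity for the partial derivatives of the
  Gram matrix, summed against the components of \<open>u\<close> and \<open>w\<close>.\<close>

lemma metric_derivative:
  assumes x: "x \<in> N"
  shows "((\<lambda>z. h z u w) has_derivative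
    (\<lambda>m. h x (contract (\<Gamma> x) m u) w + h x u (contract (\<Gamma> x) m w))) (at x)"
proof -
  let ?d = "\<lambda>l j. frechet_derivative (\<lambda>z. h z (axis l 1) (axis j 1)) (at x)"
  have d: "((\<lambda>z. h z (axis l 1) (axis j 1)) has_derivative ?d l j) (at x)" for l j
    by (rule h_has_derivative [OF x])
  have d_sum: "?d l j m = (\<Sum>k\<in>UNIV. pderiv_at k (\<lambda>z. h z (axis l 1) (axis j 1)) x * m $ k)" for l j m
    by (subst sum_pderiv_at [OF d, of m, symmetric]) (simp add: mult.commute)
  have comm: "contract (\<Gamma> x) p q = contract (\<Gamma> x) q p" for p q
    by (rule contract_commute) (rule \<Gamma>_commute [OF x])
  have comp: "h x u (contract (\<Gamma> x) w m) + h x w (contract (\<Gamma> x) u m) =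
    (\<Sum>l\<in>UNIV. \<Sum>j\<in>UNIV. \<Sum>k\<in>UNIV. pderiv_at k (\<lambda>z. h z (axis l 1) (axis j 1)) x * u $ l * w $ j * m $ k)"
    for m
    by (rule christoffel_compatible [OF bil [OF x] pos [OF x] sym [OF x]])
       (auto simp: levi_civita_def pderiv_at_sym [OF x])
  have "((\<lambda>z. \<Sum>l\<in>UNIV. \<Sum>j\<in>UNIV. h z (axis l 1) (axis j 1) * u $ l * w $ j) has_derivative
      (\<lambda>m. \<Sum>l\<in>UNIV. \<Sum>j\<in>UNIV. ?d l j m * u $ l * w $ j)) (at x)"
    by (auto intro!: derivative_eq_intros d)
  then have "((\<lambda>z. h z u w) has_derivative
      (\<lambda>m. \<Sum>l\<in>UNIV. \<Sum>j\<in>UNIV. ?d l j m * u $ l * w $ j)) (at x)"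
    by (rule has_derivative_transform_within_open [OF _ open_N x]) (rule bilinear_axis_sum [OF bil])
  moreover have "(\<Sum>l\<in>UNIV. \<Sum>j\<in>UNIV. ?d l j m * u $ l * w $ j) =
      h x (contract (\<Gamma> x) m u) w + h x u (contract (\<Gamma> x) m w)" for m
  proof -
    have "(\<Sum>l\<in>UNIV. \<Sum>j\<in>UNIV. ?d l j m * u $ l * w $ j) =
        h x u (contract (\<Gamma> x) w m) + h x w (contract (\<Gamma> x) u m)"
      unfolding comp d_sum by (simp add: sum_distrib_left sum_distrib_right mult_ac)
    also have "\<dots> = h x (contract (\<Gamma> x) m u) w + h x u (contract (\<Gamma> x) m w)"
      using comm [of m u] comm [of m w] sym [OF x, of w] by simp
    finally show ?thesis .
  qed
  ultimately show ?thesis by simp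
qed

end

section \<open>The fundamental tensor of a Kropina metric\<close>

text \<open>The Hessian of \<open>\<alpha>\<^sup>4/(2 \<beta>\<^sup>2)\<close> at \<open>y\<close>, where \<open>\<alpha>\<^sup>2(y) = B y y\<close>; this is the fundamental tensor of the
  Kropina metric \<open>\<alpha>\<^sup>2/\<beta>\<close>.\<close>

definition kropina_tensor :: "('v \<Rightarrow> 'v \<Rightarrow> real) \<Rightarrow> ('v \<Rightarrow> real) \<Rightarrow> 'v \<Rightarrow> 'v \<Rightarrow> 'v \<Rightarrow> real" where
  "kropina_tensor B \<beta> y u w =
     4 * B y u * B y w / (\<beta> y)\<^sup>2 + 2 * B y y * B u w / (\<beta> y)\<^sup>2
     - 4 * B y y * (B y w * \<beta> u + B y u * \<beta> w) / (\<beta> y) ^ 3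
     + 3 * (B y y)\<^sup>2 * \<beta> u * \<beta> w / (\<beta> y) ^ 4"

lemma fundamental_tensor_kropina:
  fixes B :: "real ^ 'n::finite \<Rightarrow> real ^ 'n \<Rightarrow> real"
  assumes bil: "bilinear B" and sym: "\<And>u w. B u w = B w u" and lin: "linear \<beta>" and y: "\<beta> y > 0"
  shows "fundamental_tensor (\<lambda>y. B y y / \<beta> y) y u w = kropina_tensor B \<beta> y u w"
proof -
  define A where "A s = B y y + 2 * s * B y u + s\<^sup>2 * B u u" for s
  define a where "a s = 2 * B y w + 2 * s * B u w" for s
  define b where "b s = \<beta> y + s * \<beta> u" for s
  have norm_exp: "B (y + s *\<^sub>R u + t *\<^sub>R w) (y + s *\<^sub>R u + t *\<^sub>R w) = A s + t * a s + t\<^sup>2 * B w w"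
    for s t
    by (simp add: bilinear_ladd [OF bil] bilinear_radd [OF bil] bilinear_lmul [OF bil]
        bilinear_rmul [OF bil] A_def a_def sym [of u y] sym [of w y] sym [of w u]
        power2_eq_square algebra_simps)
  have beta_exp: "\<beta> (y + s *\<^sub>R u + t *\<^sub>R w) = b s + t * \<beta> w" for s t
    by (simp add: linear_add [OF lin] linear_cmul [OF lin] b_def)
  have inner: "deriv (\<lambda>t. (B (y + s *\<^sub>R u + t *\<^sub>R w) (y + s *\<^sub>R u + t *\<^sub>R w)
      / \<beta> (y + s *\<^sub>R u + t *\<^sub>R w))\<^sup>2) 0 = 2 * A s * a s / (b s)\<^sup>2 - 2 * (A s)\<^sup>2 * \<beta> w / (b s) ^ 3"
    if "b s > 0" for s
    unfolding norm_exp beta_exp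
    by (rule DERIV_imp_deriv)
       (use that in \<open>auto intro!: derivative_eq_intros simp: field_simps power2_eq_square power3_eq_cube\<close>)
  have "((\<lambda>s. b s) \<longlongrightarrow> \<beta> y) (nhds 0)"
    unfolding b_def by (rule tendsto_eq_intros filterlim_ident | simp)+
  then have ev: "\<forall>\<^sub>F s in nhds 0. b s > 0"
    using y by (rule order_tendstoD)
  have "fundamental_tensor (\<lambda>y. B y y / \<beta> y) y u w =
      (1/2) * deriv (\<lambda>s. 2 * A s * a s / (b s)\<^sup>2 - 2 * (A s)\<^sup>2 * \<beta> w / (b s) ^ 3) 0"
    unfolding fundamental_tensor_def
    by (subst deriv_cong_ev [OF eventually_mono [OF ev inner] refl]) auto
  also have "deriv (\<lambda>s. 2 * A s * a s / (b s)\<^sup>2 - 2 * (A s)\<^sup>2 * \<beta> w / (b s) ^ 3) 0 =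
      2 * kropina_tensor B \<beta> y u w"
    unfolding A_def a_def b_def
    by (rule DERIV_imp_deriv)
       (use y in \<open>auto intro!: derivative_eq_intros simp: kropina_tensor_def field_simps
          power2_eq_square power3_eq_cube power4_eq_xxxx\<close>)
  finally show ?thesis by simp
qed

lemma bilinear_kropina_tensor:
  assumes "bilinear B" "linear \<beta>"
  shows "bilinear (kropina_tensor B \<beta> y)"
proof -
  obtain a b c d where *: "kropina_tensor B \<beta> y =
      (\<lambda>u w. a * (B y u * B y w) + b * B u w - c * (B y w * \<beta> u + B y u * \<beta> w) + d * (\<beta> u * \<beta> w))"
  proof
    show "kropina_tensor B \<beta> y = (\<lambda>u w. 4 / (\<beta> y)\<^sup>2 * (B y u * B y w) + 2 * B y y / (\<beta> y)\<^sup>2 * B u w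
        - 4 * B y y / (\<beta> y) ^ 3 * (B y w * \<beta> u + B y u * \<beta> w)
        + 3 * (B y y)\<^sup>2 / (\<beta> y) ^ 4 * (\<beta> u * \<beta> w))"
      by (simp add: kropina_tensor_def fun_eq_iff)
  qed
  show ?thesis
    unfolding * by (auto simp: bilinear_def bilinear_arith [OF assms(1)] linear_add [OF assms(2)]
      linear_cmul [OF assms(2)] algebra_simps intro!: linearI)
qed

lemma kropina_tensor_commute:
  assumes "\<And>u w. B u w = B w u"
  shows "kropina_tensor B \<beta> y u w = kropina_tensor B \<beta> y w u"
  by (simp add: kropina_tensor_def assms [of u w] algebra_simps)

text \<open>With \<open>p = 2 B(y, u)\<close>, \<open>q = B(y, y) \<beta>(u)/\<beta>(y)\<close> and \<open>r = 2 B(y, y) B(u, u)\<close> the quadratic form is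
  \<open>(p\<^sup>2 - 4pq + 3q\<^sup>2 + r)/\<beta>(y)\<^sup>2\<close>, where \<open>r \<ge> p\<^sup>2/2\<close> by the Cauchy-Schwarz inequality. The form \<open>(3/2)p\<^sup>2 - 4pq + 3q\<^sup>2\<close> has negative discriminant.\<close>

lemma kropina_tensor_pos:
  fixes B :: "'v::real_vector \<Rightarrow> 'v \<Rightarrow> real"
  assumes bil: "bilinear B" and sym: "\<And>u w. B u w = B w u"
    and pos: "\<And>u. u \<noteq> 0 \<Longrightarrow> B u u > 0" and lin: "linear \<beta>" and y: "\<beta> y > 0" and u: "u \<noteq> 0"
  shows "kropina_tensor B \<beta> y u u > 0"
proof -
  have A: "B y y > 0" using y linear_0 [OF lin] by (intro pos) auto
  define p where "p = 2 * B y u"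
  define q where "q = B y y * \<beta> u / \<beta> y"
  define r where "r = 2 * B y y * B u u"
  have eq: "kropina_tensor B \<beta> y u u = (p\<^sup>2 - 4 * p * q + 3 * q\<^sup>2 + r) / (\<beta> y)\<^sup>2"
    using y by (simp add: kropina_tensor_def p_def q_def r_def field_simps power2_eq_square
        power3_eq_cube power4_eq_xxxx)
  have cs: "p\<^sup>2 / 2 \<le> r"
  proof -
    have "0 \<le> B (B y y *\<^sub>R u - B y u *\<^sub>R y) (B y y *\<^sub>R u - B y u *\<^sub>R y)"
      using pos bilinear_lzero [OF bil] by (metis less_eq_real_def)
    also have "\<dots> = B y y * (B y y * B u u - (B y u)\<^sup>2)"
      by (simp add: bilinear_lsub [OF bil] bilinear_rsub [OF bil] bilinear_lmul [OF bil]
          bilinear_rmul [OF bil] sym [of u y] power2_eq_square algebra_simps)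
    finally have "(B y u)\<^sup>2 \<le> B y y * B u u" using A by (simp add: zero_le_mult_iff)
    then show ?thesis by (simp add: p_def r_def power2_eq_square)
  qed
  have r: "r > 0" using A pos [OF u] by (simp add: r_def)
  have "p\<^sup>2 - 4 * p * q + 3 * q\<^sup>2 + r > 0"
  proof (cases "q = 0")
    case True
    then show ?thesis using r by (simp add: add_nonneg_pos)
  next
    case False
    have "p\<^sup>2 - 4 * p * q + 3 * q\<^sup>2 + r \<ge> (3/2) * (p - (4/3) * q)\<^sup>2 + q\<^sup>2 / 3"
      using cs by (simp add: power2_eq_square algebra_simps)
    moreover have "(3/2) * (p - (4/3) * q)\<^sup>2 + q\<^sup>2 / 3 > 0"
      using False by (simp add: add_nonneg_pos)
    ultimately show ?thesis by linarith
  qed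
  then show ?thesis using y by (simp add: eq)
qed

text \<open>By Euler's theorem for the homogeneous function \<open>F\<^sup>2\<close>, the right-hand side is half its derivative at \<open>y\<close>
  in the direction \<open>u\<close>.\<close>

lemma kropina_tensor_base:
  assumes "\<beta> y > 0"
  shows "kropina_tensor B \<beta> y y u = 2 * B y y * B y u / (\<beta> y)\<^sup>2 - (B y y)\<^sup>2 * \<beta> u / (\<beta> y) ^ 3"
  using assms by (simp add: kropina_tensor_def field_simps power2_eq_square power3_eq_cube power4_eq_xxxx)

lemma kropina_tensor_differentiable:
  fixes B :: "'z::real_normed_vector \<Rightarrow> 'v \<Rightarrow> 'v \<Rightarrow> real"
  assumes "\<And>u w. (\<lambda>z. B z u w) differentiable (at x)" "\<And>u. (\<lambda>z. \<beta> z u) differentiable (at x)"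
    and "\<beta> x y \<noteq> 0"
  shows "(\<lambda>z. kropina_tensor (B z) (\<beta> z) y u w) differentiable (at x)"
  unfolding kropina_tensor_def
  by (intro differentiable_add differentiable_diff differentiable_divide differentiable_mult
      differentiable_power differentiable_const assms) (use assms(3) in auto)

text \<open>The first part says that the Cartan tensor vanishes when contracted with \<open>y\<close>, a consequence of the
  homogeneity of \<open>F\<close>. It is what eliminates the nonlinear connection below.\<close>

lemma kropina_tensor_base_derivative:
  fixes B :: "'v::euclidean_space \<Rightarrow> 'v \<Rightarrow> real"
  assumes bil: "bilinear B" and sym: "\<And>u w. B u w = B w u" and lin: "linear \<beta>" and y: "\<beta> y > 0"
  shows "((\<lambda>v. kropina_tensor B \<beta> v y y) has_derivative (\<lambda>m. 0)) (at y)"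
    and "(\<lambda>v. kropina_tensor B \<beta> v u w) differentiable (at y)"
proof -
  interpret B: bounded_bilinear B using bil by (simp add: bilinear_conv_bounded_bilinear)
  have 1: "((\<lambda>v. B v v) has_derivative (\<lambda>m. 2 * B m y)) (at y)"
    by (rule has_derivative_eq_rhs, rule B.FDERIV, (rule has_derivative_ident)+) (auto simp: sym [of y])
  have 2: "((\<lambda>v. B v u) has_derivative (\<lambda>m. B m u)) (at y)" for u
    by (rule bounded_linear_imp_has_derivative) (rule B.bounded_linear_left)
  have 3: "(\<beta> has_derivative \<beta>) (at y)"
    using lin by (simp add: bounded_linear_imp_has_derivative linear_conv_bounded_linear)
  \<comment> \<open>In terms of \<open>r\<close> and \<open>s\<close> the tensor is a polynomial, and at \<open>y\<close> the two derivatives are proportional.\<close>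
  define r where "r v = B v y / \<beta> v" for v
  define s where "s v = B v v / (\<beta> v)\<^sup>2" for v
  define r' where "r' m = (B m y * \<beta> y - B y y * \<beta> m) / (\<beta> y * \<beta> y)" for m
  have r: "(r has_derivative r') (at y)"
    unfolding r_def r'_def using y by (intro has_derivative_divide' 2 3) auto
  have "(s has_derivative (\<lambda>m. (2 * B m y * (\<beta> y)\<^sup>2 - B y y * (of_nat 2 * \<beta> m * \<beta> y ^ (2 - 1)))
      / ((\<beta> y)\<^sup>2 * (\<beta> y)\<^sup>2))) (at y)"
    unfolding s_def using y by (intro has_derivative_divide' has_derivative_power 1 3) auto
  also have "(\<lambda>m. (2 * B m y * (\<beta> y)\<^sup>2 - B y y * (of_nat 2 * \<beta> m * \<beta> y ^ (2 - 1)))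
      / ((\<beta> y)\<^sup>2 * (\<beta> y)\<^sup>2)) = (\<lambda>m. 2 / \<beta> y * r' m)"
    using y by (simp add: fun_eq_iff r'_def field_simps power2_eq_square)
  finally have s: "(s has_derivative (\<lambda>m. 2 / \<beta> y * r' m)) (at y)" .
  have "((\<lambda>v. 4 * (r v * r v) + 2 * B y y * s v - 8 * \<beta> y * (r v * s v) + 3 * (\<beta> y)\<^sup>2 * (s v * s v))
     has_derivative (\<lambda>m. 4 * (r y * r' m + r' m * r y) + 2 * B y y * (2 / \<beta> y * r' m)
       - 8 * \<beta> y * (r y * (2 / \<beta> y * r' m) + r' m * s y)
       + 3 * (\<beta> y)\<^sup>2 * (s y * (2 / \<beta> y * r' m) + (2 / \<beta> y * r' m) * s y))) (at y)"
    by (intro has_derivative_add has_derivative_diff has_derivative_mult_right has_derivative_mult r s)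
  also have "(\<lambda>m. 4 * (r y * r' m + r' m * r y) + 2 * B y y * (2 / \<beta> y * r' m)
       - 8 * \<beta> y * (r y * (2 / \<beta> y * r' m) + r' m * s y)
       + 3 * (\<beta> y)\<^sup>2 * (s y * (2 / \<beta> y * r' m) + (2 / \<beta> y * r' m) * s y)) = (\<lambda>m. 0)"
    using y by (simp add: fun_eq_iff r_def s_def field_simps power2_eq_square)
  also have "(\<lambda>v. 4 * (r v * r v) + 2 * B y y * s v - 8 * \<beta> y * (r v * s v) + 3 * (\<beta> y)\<^sup>2 * (s v * s v))
      = (\<lambda>v. kropina_tensor B \<beta> v y y)"
    by (simp add: fun_eq_iff r_def s_def kropina_tensor_def power2_eq_square power3_eq_cube
        power4_eq_xxxx algebra_simps)
  finally show "((\<lambda>v. kropina_tensor B \<beta> v y y) has_derivative (\<lambda>m. 0)) (at y)" .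
  have "(\<lambda>v. B v v) differentiable (at y)" "(\<lambda>v. B v u) differentiable (at y)"
     "(\<lambda>v. B v w) differentiable (at y)" "\<beta> differentiable (at y)"
    using 1 2 3 unfolding differentiable_def by blast+
  then show "(\<lambda>v. kropina_tensor B \<beta> v u w) differentiable (at y)"
    unfolding kropina_tensor_def
    by (intro differentiable_add differentiable_diff differentiable_divide differentiable_mult
        differentiable_power differentiable_const) (use y in auto)
qed

section \<open>Kropina metrics whose Chern connection is the Levi-Civita connection\<close>

text \<open>The situation of the theorem in one chart: \<open>b\<close> is the covector field dual to \<open>X\<close>, and the Chern
  connection of \<open>h(w, w)/b(w)\<close> agrees with the Levi-Civita connection wherever \<open>b\<close> is positive.\<close>

locale kropina_chart = riemannian_chart N h
  for N :: "(real ^ 'n::finite) set" and h +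
  fixes b :: "real ^ 'n \<Rightarrow> real ^ 'n \<Rightarrow> real"
  assumes b_linear: "z \<in> N \<Longrightarrow> linear (b z)"
    and b_diff: "z \<in> N \<Longrightarrow> (\<lambda>z. b z u) differentiable (at z)"
    and chern_eq: "z \<in> N \<Longrightarrow> b z w > 0 \<Longrightarrow>
      chern (\<lambda>z w. h z w w / b z w) z w i j k = levi_civita (\<lambda>z. \<chi> i j. h z (axis i 1) (axis j 1)) z i j k"
begin

abbreviation L :: "real ^ 'n \<Rightarrow> real ^ 'n \<Rightarrow> real" where
  "L \<equiv> \<lambda>z w. h z w w / b z w"

abbreviation \<T> :: "real ^ 'n \<Rightarrow> real ^ 'n \<Rightarrow> real ^ 'n \<Rightarrow> real ^ 'n \<Rightarrow> real" where
  "\<T> z \<equiv> kropina_tensor (h z) (b z)"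

lemma open_base: "open {z \<in> N. b z y > 0}"
proof -
  have "continuous_on N (\<lambda>z. b z y)"
    using b_diff by (intro differentiable_imp_continuous_on)
      (auto simp: differentiable_on_def intro: differentiable_at_withinI)
  from continuous_open_preimage [OF this open_N open_greaterThan [of 0]]
  show ?thesis by (simp add: vimage_def Int_def)
qed

lemma open_cone:
  assumes "z \<in> N"
  shows "open {w. b z w > 0}"
proof -
  have "continuous_on UNIV (b z)"
    using b_linear [OF assms] by (simp add: linear_continuous_on linear_conv_bounded_linear)
  then show ?thesis by (intro open_Collect_less continuous_on_const)
qed

lemma fund_matrix_eq:
  assumes "z \<in> N" "b z w > 0"
  shows "fund_matrix L z w = (\<chi> i j. \<T> z w (axis i 1) (axis j 1))"
  using assms
  by (simp add: fund_matrix_def fundamental_tensor_kropina [OF bil sym b_linear])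

text \<open>A function that is independent of the fibre variable on the open cone has only base derivatives, and
  the coefficients of the nonlinear connection multiply zeros.\<close>

lemma horizontal_deriv_eq:
  assumes x: "x \<in> N" "b x y > 0"
    and base: "\<And>z. z \<in> N \<Longrightarrow> b z y > 0 \<Longrightarrow> S z y = f z"
    and fibre: "\<And>w. b x w > 0 \<Longrightarrow> S x w = f x"
  shows "horizontal_deriv L' k S x y = pderiv_at k f x"
proof -
  have "pderiv_at k (\<lambda>z. S z y) x = pderiv_at k f x"
    by (rule pderiv_at_cong [OF open_base [of y]]) (use x base in auto)
  moreover have "pderiv_at m (S x) y = 0" for m
    using pderiv_at_cong [OF open_cone [OF x(1)], of y "S x" "\<lambda>_. f x" m] x(2) fibre by simp
  ultimately show ?thesis by (simp add: horizontal_deriv_def)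
qed

text \<open>The hypothesis on \<open>S\<close> is restricted to the cone, so that the lemma applies to a Chern derivative again:
  off the cone the Chern symbols are not controlled.\<close>

lemma chern_cov_eq:
  assumes x: "x \<in> N" "b x y > 0"
    and base: "\<And>z. z \<in> N \<Longrightarrow> b z y > 0 \<Longrightarrow> S z y = W z"
    and fibre: "\<And>w. b x w > 0 \<Longrightarrow> S x w = W x"
  shows "chern_cov L U S x y = affine_cov \<Gamma> U W x"
proof -
  have "horizontal_deriv L k (\<lambda>z w. S z w $ i) x y = pderiv_at k (\<lambda>z. W z $ i) x" for k i
    by (rule horizontal_deriv_eq [OF x]) (simp_all add: base fibre)
  then show ?thesis
    by (simp add: chern_cov_def affine_cov_def chern_eq [OF x] base [OF x])
qed

lemma chern_curv_eq_affine_curv: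
  assumes x: "x \<in> N" "b x y > 0"
  shows "chern_curv L U V W x y = affine_curv \<Gamma> U V W x"
  unfolding chern_curv_def affine_curv_def
  by (intro arg_cong2 [where f = "(-)"] chern_cov_eq x refl)

text \<open>The Chern connection is compatible with the fundamental tensor along horizontal directions.
  Contracting twice with \<open>y\<close> yields \<open>2 g\<^sub>y(y, \<Gamma>(y, m)) = \<partial>\<^sub>m F\<^sup>2\<close>. Since \<open>\<partial>\<^sub>m \<alpha>\<^sup>2 = 2 h(y, \<Gamma>(y, m))\<close>, the
  terms with derivatives of \<open>\<alpha>\<^sup>2\<close> cancel and those with \<open>\<beta>\<close> remain.\<close>

lemma b_derivative_on_cone:
  assumes x: "x \<in> N" and y: "b x y > 0"
  shows "frechet_derivative (\<lambda>z. b z y) (at x) m = b x (contract (\<Gamma> x) m y)"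
proof -
  let ?D = "\<lambda>l j k. horizontal_deriv L k (\<lambda>z w. fund_matrix L z w $ l $ j) x y"
  let ?e = "\<lambda>i. axis i (1::real) :: real ^ 'n"
  let ?d = "\<lambda>l j. frechet_derivative (\<lambda>z. \<T> z y (?e l) (?e j)) (at x)"
  let ?v = "\<lambda>l j. frechet_derivative (\<lambda>w. \<T> x w (?e l) (?e j)) (at y)"
  define A where "A = h x y y"
  define \<beta> where "\<beta> = b x y"
  define G where "G = contract (\<Gamma> x) y m"
  have sw: "contract (\<Gamma> x) m y = G"
    unfolding G_def by (rule contract_commute) (rule \<Gamma>_commute [OF x])
  have \<beta>: "\<beta> > 0" using y by (simp add: \<beta>_def)
  have "y \<noteq> 0" using y linear_0 [OF b_linear [OF x]] by auto
  then have A: "A > 0" unfolding A_def by (rule pos [OF x])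
  have bilT: "bilinear (\<T> z w)" if "z \<in> N" for z w
    by (rule bilinear_kropina_tensor [OF bil [OF that] b_linear [OF that]])
  have d: "((\<lambda>z. \<T> z y (?e l) (?e j)) has_derivative ?d l j) (at x)" for l j
    using kropina_tensor_differentiable [of h x b y] diff1 [OF x] b_diff [OF x] y
    by (simp add: frechet_derivative_works [symmetric])
  have v: "((\<lambda>w. \<T> x w (?e l) (?e j)) has_derivative ?v l j) (at y)" for l j
    using kropina_tensor_base_derivative(2) [OF bil [OF x] sym [OF x] b_linear [OF x] y]
    by (simp add: frechet_derivative_works [symmetric])
  define n where "n k = (\<chi> q. nonlinear_connection L x y q k)" for k
  have D: "?D l j k = ?d l j (?e k) - ?v l j (n k)" for l j k
  proof -
    have "pderiv_at k (\<lambda>z. fund_matrix L z y $ l $ j) x = pderiv_at k (\<lambda>z. \<T> z y (?e l) (?e j)) x"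
      by (rule pderiv_at_cong [OF open_base [of y]]) (use x y in \<open>auto simp: fund_matrix_eq\<close>)
    moreover have "pderiv_at q (\<lambda>w. fund_matrix L x w $ l $ j) y = pderiv_at q (\<lambda>w. \<T> x w (?e l) (?e j)) y"
      for q
      by (rule pderiv_at_cong [OF open_cone [OF x]]) (use x y in \<open>auto simp: fund_matrix_eq\<close>)
    ultimately show ?thesis
      using linear_axis_sum [OF has_derivative_linear [OF v], of "n k" l j]
      by (simp add: horizontal_deriv_def pderiv_at_eq [OF d] pderiv_at_eq [OF v] n_def)
  qed
  \<comment> \<open>The fibre part of the horizontal derivatives is a Cartan tensor and dies on \<open>y\<close>.\<close>
  have v0: "(\<Sum>l\<in>UNIV. \<Sum>j\<in>UNIV. ?v l j q * y $ l * y $ j) = 0" for q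
  proof -
    have "((\<lambda>w. \<Sum>l\<in>UNIV. \<Sum>j\<in>UNIV. \<T> x w (?e l) (?e j) * y $ l * y $ j) has_derivative
        (\<lambda>q. \<Sum>l\<in>UNIV. \<Sum>j\<in>UNIV. ?v l j q * y $ l * y $ j)) (at y)"
      by (intro has_derivative_sum has_derivative_mult_left v)
    then have "((\<lambda>w. \<T> x w y y) has_derivative
        (\<lambda>q. \<Sum>l\<in>UNIV. \<Sum>j\<in>UNIV. ?v l j q * y $ l * y $ j)) (at y)"
      unfolding bilinear_axis_sum [OF bilT [OF x]] .
    from has_derivative_unique [OF this
        kropina_tensor_base_derivative(1) [OF bil [OF x] sym [OF x] b_linear [OF x] y]]
    show ?thesis by (simp add: fun_eq_iff)
  qed
  \<comment> \<open>The base part becomes the derivative of \<open>F\<^sup>2 = \<alpha>\<^sup>4/\<beta>\<^sup>2\<close> at fixed \<open>y\<close>.\<close>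
  define \<beta>' where "\<beta>' = frechet_derivative (\<lambda>z. b z y) (at x)"
  have \<beta>': "((\<lambda>z. b z y) has_derivative \<beta>') (at x)"
    unfolding \<beta>'_def using b_diff [OF x] by (simp add: frechet_derivative_works)
  define \<delta> where "\<delta> m = (\<Sum>l\<in>UNIV. \<Sum>j\<in>UNIV. ?d l j m * y $ l * y $ j)" for m
  have \<delta>: "((\<lambda>z. \<Sum>l\<in>UNIV. \<Sum>j\<in>UNIV. \<T> z y (?e l) (?e j) * y $ l * y $ j) has_derivative \<delta>) (at x)"
    unfolding \<delta>_def by (intro has_derivative_sum has_derivative_mult_left d)
  have d_sum: "\<delta> m =
      4 * A * h x y G / \<beta>\<^sup>2 - 2 * A\<^sup>2 * \<beta>' m / \<beta> ^ 3"
  proof -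
    from \<delta> have 1: "((\<lambda>z. (h z y y)\<^sup>2 / (b z y)\<^sup>2) has_derivative \<delta>) (at x)"
    proof (rule has_derivative_transform_within_open [OF _ open_base [of y]])
      fix z assume z: "z \<in> {z \<in> N. b z y > 0}"
      then show "(\<Sum>l\<in>UNIV. \<Sum>j\<in>UNIV. \<T> z y (?e l) (?e j) * y $ l * y $ j) = (h z y y)\<^sup>2 / (b z y)\<^sup>2"
        using bilinear_axis_sum [OF bilT [of z]]
        by (simp add: kropina_tensor_base field_simps power2_eq_square power3_eq_cube)
    qed (use x y in auto)
    have h': "((\<lambda>z. h z y y) has_derivative (\<lambda>m. 2 * h x y (contract (\<Gamma> x) m y))) (at x)"
      by (rule has_derivative_eq_rhs [OF metric_derivative [OF x]]) (simp add: fun_eq_iff sym [OF x, of y])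
    have "((\<lambda>z. (h z y y)\<^sup>2 / (b z y)\<^sup>2) has_derivative
        (\<lambda>m. (of_nat 2 * (2 * h x y (contract (\<Gamma> x) m y)) * h x y y ^ (2 - 1) * (b x y)\<^sup>2
          - (h x y y)\<^sup>2 * (of_nat 2 * \<beta>' m * b x y ^ (2 - 1))) / ((b x y)\<^sup>2 * (b x y)\<^sup>2))) (at x)"
      using y by (intro has_derivative_divide' has_derivative_power h' \<beta>') auto
    from fun_cong [OF has_derivative_unique [OF 1 this], of m]
    have "\<delta> m = (of_nat 2 * (2 * h x y G) * A ^ (2 - 1) * \<beta>\<^sup>2 - A\<^sup>2 * (of_nat 2 * \<beta>' m * \<beta> ^ (2 - 1))) / (\<beta>\<^sup>2 * \<beta>\<^sup>2)"
      by (simp only: sw A_def \<beta>_def)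
    also have "\<dots> = 4 * A * h x y G / \<beta>\<^sup>2 - 2 * A\<^sup>2 * \<beta>' m / \<beta> ^ 3"
      using \<beta> by (simp add: field_simps power2_eq_square power3_eq_cube)
    finally show ?thesis .
  qed
  have \<Gamma>_eq: "\<Gamma> x = christoffel (\<chi> i j. \<T> x y (?e i) (?e j)) ?D"
    using chern_eq [OF x y] by (simp add: chern_def fun_eq_iff fund_matrix_eq [OF x y, symmetric])
  have T_sym: "\<T> z w p q = \<T> z w q p" if "z \<in> N" for z w p q
    by (rule kropina_tensor_commute) (rule sym [OF that])
  have "2 * \<T> x y y G = (\<Sum>l\<in>UNIV. \<Sum>j\<in>UNIV. \<Sum>k\<in>UNIV. ?D l j k * y $ l * y $ j * m $ k)"
    unfolding G_def mult_2
  proof (rule christoffel_compatible [OF bilT [OF x] _ T_sym [OF x] _ \<Gamma>_eq])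
    show "\<T> x y u u > 0" if "u \<noteq> 0" for u
      by (rule kropina_tensor_pos [OF bil [OF x] sym [OF x] pos [OF x] b_linear [OF x] y that])
    show "?D l j k = ?D j l k" for l j k
    proof -
      have "pderiv_at k (\<lambda>z. \<T> z y (?e l) (?e j)) x = pderiv_at k (\<lambda>z. \<T> z y (?e j) (?e l)) x"
        by (rule pderiv_at_cong [OF open_N x]) (rule T_sym)
      then show ?thesis
        by (simp add: D pderiv_at_eq [OF d] T_sym [OF x, of _ "?e l" "?e j"])
    qed
  qed
  also have "\<dots> = (\<Sum>l\<in>UNIV. \<Sum>k\<in>UNIV. \<Sum>j\<in>UNIV. ?D l j k * y $ l * y $ j * m $ k)"
    by (intro sum.cong refl sum.swap)
  also have "\<dots> = (\<Sum>k\<in>UNIV. \<Sum>l\<in>UNIV. \<Sum>j\<in>UNIV. ?D l j k * y $ l * y $ j * m $ k)"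
    by (rule sum.swap)
  also have "\<dots> = (\<Sum>k\<in>UNIV. m $ k * ((\<Sum>l\<in>UNIV. \<Sum>j\<in>UNIV. ?d l j (?e k) * y $ l * y $ j)
      - (\<Sum>l\<in>UNIV. \<Sum>j\<in>UNIV. ?v l j (n k) * y $ l * y $ j)))"
    unfolding D by (simp add: sum_distrib_left sum_subtractf algebra_simps)
  also have "\<dots> = (\<Sum>k\<in>UNIV. m $ k *\<^sub>R \<delta> (?e k))"
    unfolding v0 \<delta>_def by simp
  also have "\<dots> = \<delta> m" by (rule linear_axis_sum [OF has_derivative_linear [OF \<delta>]])
  finally have "2 * \<T> x y y G = 4 * A * h x y G / \<beta>\<^sup>2 - 2 * A\<^sup>2 * \<beta>' m / \<beta> ^ 3"
    unfolding d_sum .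
  moreover have "2 * \<T> x y y G = 4 * A * h x y G / \<beta>\<^sup>2 - 2 * A\<^sup>2 * b x G / \<beta> ^ 3"
    using kropina_tensor_base [of "b x" y "h x" G] y by (simp add: A_def \<beta>_def)
  ultimately have "2 * A\<^sup>2 * b x G / \<beta> ^ 3 = 2 * A\<^sup>2 * \<beta>' m / \<beta> ^ 3" by linarith
  then have "b x G = \<beta>' m" using A \<beta> by simp
  then show ?thesis
    by (simp add: \<beta>'_def sw)
qed

text \<open>Both sides are linear in \<open>u\<close>, and every vector is a difference of two vectors in the cone.\<close>

lemma b_parallel:
  assumes x: "x \<in> N" and y: "b x y > 0"
  shows "((\<lambda>z. b z u) has_derivative (\<lambda>m. b x (contract (\<Gamma> x) m u))) (at x)"
proof -
  interpret bx: linear "b x" by (rule b_linear [OF x])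
  \<comment> \<open>Large enough for \<open>u + s *\<^sub>R y\<close> to lie in the cone.\<close>
  define s where "s = (\<bar>b x u\<bar> + 1) / b x y"
  have on_cone: "((\<lambda>z. b z w) has_derivative (\<lambda>m. b x (contract (\<Gamma> x) m w))) (at x)" if "b x w > 0" for w
  proof -
    have "frechet_derivative (\<lambda>z. b z w) (at x) = (\<lambda>m. b x (contract (\<Gamma> x) m w))"
      by (rule ext) (rule b_derivative_on_cone [OF x that])
    then show ?thesis using b_diff [OF x, of w] by (simp add: frechet_derivative_works)
  qed
  have "b x (u + s *\<^sub>R y) > 0" using y by (simp add: bx.add bx.scaleR s_def)
  from has_derivative_diff [OF on_cone [OF this] has_derivative_scaleR_right [OF on_cone [OF y]]]
  have "((\<lambda>z. b z (u + s *\<^sub>R y) - s *\<^sub>R b z y) has_derivative (\<lambda>m. b x (contract (\<Gamma> x) m u))) (at x)"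
    by (rule has_derivative_eq_rhs)
       (simp add: fun_eq_iff bx.add bx.scaleR bilinear_radd [OF bilinear_contract]
          bilinear_rmul [OF bilinear_contract])
  then show ?thesis
    by (rule has_derivative_transform_within_open [OF _ open_N x])
       (simp add: linear_add [OF b_linear] linear_cmul [OF b_linear])
qed

end

section \<open>Charts and left invariant fields of a Lie group\<close>

lemma smooth_on_differentiable:
  assumes "smooth_on S f" "x \<in> S"
  shows "f differentiable (at x)"
  using assms unfolding smooth_on_def by (metis Ck_on.simps(2))

lemma smooth_on_frechet_derivative:
  assumes "smooth_on S f"
  shows "smooth_on S (\<lambda>x. frechet_derivative f (at x) v)"
  using assms unfolding smooth_on_def by (metis Ck_on.simps(2))

lemma smooth_on_differentiable2:
  assumes "smooth_on S f" "x \<in> S"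
  shows "(\<lambda>x. frechet_derivative f (at x) v) differentiable (at x)"
  by (rule smooth_on_differentiable [OF smooth_on_frechet_derivative]) (rule assms)+

context
  fixes F :: "'a::euclidean_space \<times> 'b::euclidean_space \<Rightarrow> 'c::real_normed_vector" and S e a
  assumes F: "smooth_on S F" and a: "(a, e) \<in> S"
begin

lemma has_derivative_first:
  "((\<lambda>z. F (z, e)) has_derivative (\<lambda>u. frechet_derivative F (at (a, e)) (u, 0))) (at a)"
proof -
  have "(F has_derivative frechet_derivative F (at (a, e))) (at (a, e))"
    using smooth_on_differentiable [OF F a] by (simp add: frechet_derivative_works)
  then show ?thesis
    by (rule has_derivative_compose [where f = "\<lambda>z. (z, e)", rotated]) (auto intro!: derivative_eq_intros)
qed

lemma has_derivative_second:
  "((\<lambda>w. F (a, w)) has_derivative (\<lambda>u. frechet_derivative F (at (a, e)) (0, u))) (at e)"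
proof -
  have "(F has_derivative frechet_derivative F (at (a, e))) (at (a, e))"
    using smooth_on_differentiable [OF F a] by (simp add: frechet_derivative_works)
  then show ?thesis
    by (rule has_derivative_compose [where f = "\<lambda>w. (a, w)", rotated]) (auto intro!: derivative_eq_intros)
qed

end

context lie_group
begin

lemma chart_dom_subset: "c \<in> A \<Longrightarrow> chart_dom c \<subseteq> carrier G"
  using covering topspace_eq by blast

lemma point_of_coords:
  assumes "c \<in> A" "p \<in> chart_dom c"
  shows "point_of c (coords c p) = p"
proof -
  have "inj_on (coords c) (topspace (subtopology T (chart_dom c)))"
    using charts [OF assms(1)] unfolding is_chart_def by (metis homeomorphic_imp_injective_map)
  then have "inj_on (coords c) (chart_dom c)"
    using chart_dom_subset [OF assms(1)] topspace_eq by (simp add: Int_absorb1)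
  then show ?thesis using assms(2) by (simp add: point_of_def)
qed

lemma open_chart_img: "c \<in> A \<Longrightarrow> open (chart_img c)"
  using charts unfolding is_chart_def by blast

lemma point_of_in:
  assumes "c \<in> A" "a \<in> chart_img c"
  shows "point_of c a \<in> chart_dom c" "coords c (point_of c a) = a"
  using assms(2) point_of_coords [OF assms(1)] by auto

context
  fixes c
  assumes c: "c \<in> A" and one: "\<one> \<in> chart_dom c"
begin

text \<open>A left invariant field is a partial derivative, in the second variable, of the smooth multiplication
  map along \<open>b = coords c \<one>\<close>; hence it inherits derivatives of every order in the first variable. Two of them
  enter the curvature.\<close>

lemma left_ext_smooth_data:
  obtains W' W'' where "\<And>a. a \<in> chart_img c \<Longrightarrow> (left_ext G c u has_derivative W' a) (at a)"
    and "\<And>a v. a \<in> chart_img c \<Longrightarrow> ((\<lambda>a. W' a v) has_derivative W'' a v) (at a)"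
proof -
  let ?e = "coords c \<one>"
  define F where "F = (\<lambda>(a, b). coords c (point_of c a \<otimes> point_of c b))"
  define S where "S = {(a, b). a \<in> chart_img c \<and> b \<in> chart_img c \<and>
    point_of c a \<otimes> point_of c b \<in> chart_dom c}"
  have F: "smooth_on S F" unfolding S_def F_def by (rule smooth_mult [OF c c c])
  have aS: "(a, ?e) \<in> S" if "a \<in> chart_img c" for a
    using that one point_of_in [OF c that] chart_dom_subset [OF c]
    by (auto simp: S_def point_of_coords [OF c one])
  let ?E = "\<lambda>p. frechet_derivative F (at p) (0, u)"
  have E: "smooth_on S ?E" by (rule smooth_on_frechet_derivative [OF F])
  let ?E' = "\<lambda>v p. frechet_derivative ?E (at p) (v, 0)"
  have E': "smooth_on S (?E' v)" for v by (rule smooth_on_frechet_derivative [OF E])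
  have ext: "left_ext G c u a = ?E (a, ?e)" if a: "a \<in> chart_img c" for a
    using frechet_derivative_at [OF has_derivative_second [OF F aS [OF a]]]
    by (simp add: left_ext_def tangent_map_def F_def fun_eq_iff)
  show ?thesis
  proof
    show "(left_ext G c u has_derivative (\<lambda>v. ?E' v (a, ?e))) (at a)" if a: "a \<in> chart_img c" for a
      by (rule has_derivative_transform_within_open [OF has_derivative_first [OF E aS [OF a]]
          open_chart_img [OF c] a]) (simp add: ext)
    show "((\<lambda>a. ?E' v (a, ?e)) has_derivative
        (\<lambda>w. frechet_derivative (?E' v) (at (a, ?e)) (w, 0))) (at a)" if a: "a \<in> chart_img c" for a v
      by (rule has_derivative_first [OF E' aS [OF a]])
  qed
qed

lemma left_ext_one: "left_ext G c u (coords c \<one>) = u"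
proof -
  have "a = coords c (\<one> \<otimes> point_of c a)" if "a \<in> chart_img c" for a
    using point_of_in [OF c that] chart_dom_subset [OF c] by (simp add: subset_iff)
  then have "((\<lambda>a. coords c (\<one> \<otimes> point_of c a)) has_derivative (\<lambda>u. u)) (at (coords c \<one>))"
    using one by (intro has_derivative_transform_within_open [OF has_derivative_ident open_chart_img [OF c]])
      auto
  from frechet_derivative_at [OF this] show ?thesis
    by (simp add: left_ext_def tangent_map_def point_of_coords [OF c one] fun_eq_iff)
qed

end

end

lemma (in lie_group) affine_curv_left_ext:
  assumes c: "c \<in> A" "\<one> \<in> chart_dom c"
    and \<Gamma>: "\<And>i j k. ((\<lambda>z. \<Gamma> z i j k) has_derivative \<Gamma>' i j k) (at (coords c \<one>))"
  shows "affine_curv \<Gamma> (left_ext G c u) (left_ext G c v) (left_ext G c w) (coords c \<one>) =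
    curvature_form (\<Gamma> (coords c \<one>)) \<Gamma>' u v w"
proof -
  let ?x = "coords c \<one>"
  have x: "?x \<in> chart_img c" using c by auto
  obtain U' U'' where U: "\<And>a. a \<in> chart_img c \<Longrightarrow> (left_ext G c u has_derivative U' a) (at a)"
    and "\<And>a v. a \<in> chart_img c \<Longrightarrow> ((\<lambda>a. U' a v) has_derivative U'' a v) (at a)"
    using left_ext_smooth_data [OF c, of u] by blast
  obtain V' V'' where V: "\<And>a. a \<in> chart_img c \<Longrightarrow> (left_ext G c v has_derivative V' a) (at a)"
    and "\<And>a v. a \<in> chart_img c \<Longrightarrow> ((\<lambda>a. V' a v) has_derivative V'' a v) (at a)"
    using left_ext_smooth_data [OF c, of v] by blast
  obtain W' W'' where W: "\<And>a. a \<in> chart_img c \<Longrightarrow> (left_ext G c w has_derivative W' a) (at a)"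
    and W2: "\<And>a v. a \<in> chart_img c \<Longrightarrow> ((\<lambda>a. W' a v) has_derivative W'' a v) (at a)"
    using left_ext_smooth_data [OF c, of w] by blast
  show ?thesis
    using affine_curv_eq_curvature_form [OF open_chart_img [OF c(1)] x W W2 [OF x] U [OF x] V [OF x] \<Gamma>]
    by (simp add: left_ext_one [OF c])
qed

lemma (in lie_group) kropina_chart_in_coordinates:
  assumes g: "riemannian_metric A g" and X: "vector_field A X"
    and lc: "chern_eq_levi_civita A (kropina_cone g X) (kropina g X) g" and c: "c \<in> A"
  shows "kropina_chart (chart_img c) (\<lambda>z. g c (point_of c z))
    (\<lambda>z. g c (point_of c z) (X c (point_of c z)))"
proof (intro kropina_chart.intro riemannian_chart.intro kropina_chart_axioms.intro)
  let ?h = "\<lambda>z. g c (point_of c z)"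
  note p = point_of_in [OF c]
  show "open (chart_img c)" by (rule open_chart_img [OF c])
  fix z assume z: "z \<in> chart_img c"
  show bil: "bilinear (?h z)"
    using g c p(1) [OF z] by (auto simp: riemannian_metric_def)
  show "?h z u w = ?h z w u" for u w
    using g c p(1) [OF z] by (auto simp: riemannian_metric_def)
  show "?h z u u > 0" if "u \<noteq> 0" for u
    using g c p(1) [OF z] that by (auto simp: riemannian_metric_def)
  have smooth: "smooth_on (chart_img c) (\<lambda>z. ?h z u w)" for u w
    using g c by (auto simp: riemannian_metric_def)
  show diff: "(\<lambda>z. ?h z u w) differentiable (at z)" for u w
    by (rule smooth_on_differentiable [OF smooth z])
  show "(\<lambda>z. frechet_derivative (\<lambda>z. ?h z u w) (at z) v) differentiable (at z)" for u w v
    by (rule smooth_on_differentiable2 [OF smooth z])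
  show "linear (?h z (X c (point_of c z)))" using bil by (simp add: bilinear_def)
  show "(\<lambda>z. ?h z (X c (point_of c z)) u) differentiable (at z)" for u
  proof -
    have "(\<lambda>z. X c (point_of c z)) differentiable (at z)"
      using X c z by (auto simp: vector_field_def intro: smooth_on_differentiable)
    then have 1: "((\<lambda>z. X c (point_of c z)) has_derivative
        frechet_derivative (\<lambda>z. X c (point_of c z)) (at z)) (at z)"
      by (simp add: frechet_derivative_works)
    have 2: "((\<lambda>z. ?h z w u) has_derivative frechet_derivative (\<lambda>z. ?h z w u) (at z)) (at z)" for w
      using diff by (simp add: frechet_derivative_works)
    have 3: "linear (\<lambda>w. ?h z w u)" if "z \<in> chart_img c" for z
      using g c p(1) [OF that] by (auto simp: riemannian_metric_def bilinear_def)
    show ?thesis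
      unfolding differentiable_def
      by (rule exI, rule has_derivative_apply_linear
          [where F = "\<lambda>z w. ?h z w u", OF open_chart_img [OF c] z 3 2 1])
  qed
  show "chern (\<lambda>z w. ?h z w w / ?h z (X c (point_of c z)) w) z w i j k =
      levi_civita (\<lambda>z. \<chi> i j. ?h z (axis i 1) (axis j 1)) z i j k"
    if "?h z (X c (point_of c z)) w > 0" for w i j k
  proof -
    have "w \<in> kropina_cone g X c (point_of c z)" using that by (simp add: kropina_cone_def)
    then have "chern (local_finsler (kropina g X) c) z w i j k = levi_civita (local_metric g c) z i j k"
      using lc c p [OF z] unfolding chern_eq_levi_civita_def by metis
    then show ?thesis
      by (simp only: local_finsler_def [abs_def] local_metric_def [abs_def] kropina_def [abs_def])
  qed
qed

section \<open>Curvature quotients of a plane\<close>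

lemma in_span_pair_iff: "x \<in> span {v, y} \<longleftrightarrow> (\<exists>a b. x = a *\<^sub>R v + b *\<^sub>R y)"
  by (auto simp: span_insert span_singleton algebra_simps) 

text \<open>The matrices expressing the two bases in terms of each other are inverse, so their determinants have
  product 1.\<close>

lemma orthonormal_span_pair:
  fixes B :: "'v::real_vector \<Rightarrow> 'v \<Rightarrow> real"
  assumes bil: "bilinear B" and sym: "\<And>u w. B u w = B w u"
    and on: "B v v = 1" "B y y = 1" "B v y = 0" and span: "span {u, w} = span {v, y}"
  obtains a b c d where "u = a *\<^sub>R v + b *\<^sub>R y" "w = c *\<^sub>R v + d *\<^sub>R y" "a * d - b * c \<noteq> 0"
proof -
  have "u \<in> span {v, y}" "w \<in> span {v, y}" using span_base [of _ "{u, w}"] span by auto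
  then obtain a b c d where u: "u = a *\<^sub>R v + b *\<^sub>R y" and w: "w = c *\<^sub>R v + d *\<^sub>R y"
    unfolding in_span_pair_iff by blast
  have "v \<in> span {u, w}" "y \<in> span {u, w}" using span_base [of _ "{v, y}"] span by auto
  then obtain p q r s where v: "v = p *\<^sub>R u + q *\<^sub>R w" and y: "y = r *\<^sub>R u + s *\<^sub>R w"
    unfolding in_span_pair_iff by blast
  have B: "B u v = a" "B u y = b" "B w v = c" "B w y = d"
    using on sym [of y v]
    by (simp_all add: u w bilinear_ladd [OF bil] bilinear_lmul [OF bil])
  have "B v z = p * B u z + q * B w z" "B y z = r * B u z + s * B w z" for z
    by (subst v y, simp add: bilinear_ladd [OF bil] bilinear_lmul [OF bil])+
  from this [of v] this [of y] have "p * a + q * c = 1" "p * b + q * d = 0" "r * a + s * c = 0" "r * b + s * d = 1"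
    using on sym [of y v] by (simp_all add: B)
  then have "(p * a + q * c) * (r * b + s * d) - (p * b + q * d) * (r * a + s * c) = 1" by simp
  then have "(p * s - q * r) * (a * d - b * c) = 1" by (simp add: algebra_simps)
  then have "a * d - b * c \<noteq> 0" by auto
  with u w show ?thesis by (rule that)
qed

lemma gram_determinant:
  fixes B :: "'v::real_vector \<Rightarrow> 'v \<Rightarrow> real"
  assumes bil: "bilinear B" and sym: "\<And>u w. B u w = B w u"
    and u: "u = a *\<^sub>R v + b *\<^sub>R y" and w: "w = c *\<^sub>R v + d *\<^sub>R y"
  shows "B u u * B w w - (B u w)\<^sup>2 = (a * d - b * c)\<^sup>2 * (B v v * B y y - (B v y)\<^sup>2)"
  unfolding u w bilinear_ladd [OF bil] bilinear_lmul [OF bil] bilinear_radd [OF bil] bilinear_rmul [OF bil]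
  by (simp add: sym [of y v] power2_eq_square algebra_simps)

text \<open>Numerator and denominator both carry the square of the determinant of the change of basis; in the
  numerator one factor comes from the alternating pair of arguments, the other one from skewness.\<close>

lemma sectional_quotient:
  fixes B :: "'v::real_vector \<Rightarrow> 'v \<Rightarrow> real"
  assumes bil: "bilinear B" and sym: "\<And>u w. B u w = B w u"
    and on: "B v v = 1" "B y y = 1" "B v y = 0"
    and R: "\<And>a b c d z. R (a *\<^sub>R v + b *\<^sub>R y) (c *\<^sub>R v + d *\<^sub>R y) z = (a * d - b * c) *\<^sub>R R v y z"
    and lin: "linear (R v y)" and skew: "\<And>p q. B (R v y p) q + B p (R v y q) = 0"
    and u: "u = a *\<^sub>R v + b *\<^sub>R y" and w: "w = c *\<^sub>R v + d *\<^sub>R y" and det: "a * d - b * c \<noteq> 0"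
  shows "B (R u w w) u / (B u u * B w w - (B u w)\<^sup>2) = B (R v y y) v"
proof -
  have skew0: "B (R v y z) z = 0" for z using skew [of z z] sym [of z] by simp
  have swap: "B (R v y v) y = - B (R v y y) v" using skew [of v y] sym [of v] by simp
  have "B (R u w w) u = (a * d - b * c) * B (R v y w) u"
    unfolding u by (subst w, subst R) (simp add: bilinear_lmul [OF bil] u)
  also have "B (R v y w) u = (a * d - b * c) * B (R v y y) v"
    unfolding u w linear_add [OF lin] linear_cmul [OF lin] bilinear_ladd [OF bil]
      bilinear_lmul [OF bil] bilinear_radd [OF bil] bilinear_rmul [OF bil] skew0 swap
    by (simp add: algebra_simps)
  finally show ?thesis
    using det unfolding gram_determinant [OF bil sym u w] on by (simp add: power2_eq_square)
qed

text \<open>The hypotheses on \<open>r\<close> hold for \<open>r = R(v, y)y\<close>. They remove every term of \<open>g\<^sub>y(r, v)\<close> except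
  \<open>2 B(r, v)/\<beta>(y)\<^sup>2\<close>, and they give \<open>g\<^sub>y(r, y) = 0\<close>; therefore replacing \<open>v\<close> by another complement \<open>u\<close> of \<open>y\<close>
  only scales numerator and denominator by \<open>a\<^sup>2\<close>.\<close>

lemma kropina_flag_quotient:
  fixes B :: "'v::real_vector \<Rightarrow> 'v \<Rightarrow> real"
  assumes bil: "bilinear B" and sym: "\<And>u w. B u w = B w u" and lin: "linear \<beta>" and y: "\<beta> y > 0"
    and on: "B v v = 1" "B y y = 1" "B v y = 0"
    and r: "B y r = 0" "\<beta> r = 0"
    and u: "u = a *\<^sub>R v + b *\<^sub>R y" and a: "a \<noteq> 0"
  defines "T \<equiv> kropina_tensor B \<beta> y" and "F \<equiv> B y y / \<beta> y"
  shows "T (a *\<^sub>R r) u / (T y y * T u u - (T y u)\<^sup>2) = 1 / (F ^ 4 * (\<beta> v)\<^sup>2 + F\<^sup>2) * B r v"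
proof -
  have bilT: "bilinear T" unfolding T_def by (rule bilinear_kropina_tensor [OF bil lin])
  have symT: "T p q = T q p" for p q unfolding T_def by (rule kropina_tensor_commute [OF sym])
  have "T r y = 0" "T r v = 2 * B r v / (\<beta> y)\<^sup>2"
    using r on sym [of y v] sym [of y r] by (simp_all add: T_def kropina_tensor_def)
  then have num: "T (a *\<^sub>R r) u = a\<^sup>2 * (2 * B r v / (\<beta> y)\<^sup>2)"
    by (simp add: u bilinear_lmul [OF bilT] bilinear_radd [OF bilT] bilinear_rmul [OF bilT] power2_eq_square)
  define S where "S = (\<beta> v)\<^sup>2 + (\<beta> y)\<^sup>2"
  have S: "S > 0" using y by (simp add: S_def add_nonneg_pos)
  have "T v v * T y y - (T v y)\<^sup>2 = 2 * S / (\<beta> y) ^ 6"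
    using y on sym [of y v] by (simp add: T_def S_def kropina_tensor_def field_simps eval_nat_numeral)
  with gram_determinant [OF bilT symT u, of y 0 1]
  have den: "T y y * T u u - (T y u)\<^sup>2 = a\<^sup>2 * (2 * S / (\<beta> y) ^ 6)"
    by (simp add: symT [of y u] mult.commute)
  have F: "F ^ 4 * (\<beta> v)\<^sup>2 + F\<^sup>2 = S / (\<beta> y) ^ 4"
    using y by (simp add: F_def S_def on field_simps eval_nat_numeral)
  show ?thesis
    unfolding num den F using y a S by (simp add: field_simps eval_nat_numeral)
qed

section \<open>The flag curvature formula\<close>

theorem theorem3p3:
  fixes G :: "('a, 'm) monoid_scheme" and T :: "'a topology"
    and A :: "('a, 'n::finite) chart set"
    and g :: "('a, 'n) metric_field" and X :: "('a, 'n) vfield"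
    and c :: "('a, 'n) chart" and P :: "(real ^ 'n) set" and y v :: "real ^ 'n"
  assumes "lie_group G T A"
    and "riemannian_metric A g" and "left_invariant_metric G A g"
    and "vector_field A X" and "left_invariant_vfield G A X"
    and "berwald_type A (kropina_cone g X) (kropina g X)"
    and "chern_eq_levi_civita A (kropina_cone g X) (kropina g X) g"
    and "c \<in> A" and "\<one>\<^bsub>G\<^esub> \<in> chart_dom c"
    and "is_flag P y"
    and "g c \<one>\<^bsub>G\<^esub> (X c \<one>\<^bsub>G\<^esub>) y > 0"
    and "span {v, y} = P"
    and "g c \<one>\<^bsub>G\<^esub> v v = 1" and "g c \<one>\<^bsub>G\<^esub> y y = 1" and "g c \<one>\<^bsub>G\<^esub> v y = 0"
  shows "flag_curvature G (kropina g X) c P y =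
    1 / ((kropina g X c \<one>\<^bsub>G\<^esub> y) ^ 4 * (g c \<one>\<^bsub>G\<^esub> (X c \<one>\<^bsub>G\<^esub>) v)\<^sup>2 + (kropina g X c \<one>\<^bsub>G\<^esub> y)\<^sup>2)
      * sectional_curvature G g c P"
proof -
  interpret lie_group G T A by fact
  note c = \<open>c \<in> A\<close> \<open>\<one>\<^bsub>G\<^esub> \<in> chart_dom c\<close> and on = assms(13-15)
  interpret kropina_chart "chart_img c" "\<lambda>z. g c (point_of c z)"
    "\<lambda>z. g c (point_of c z) (X c (point_of c z))"
    by (rule kropina_chart_in_coordinates) fact+
  define x where "x = coords c \<one>\<^bsub>G\<^esub>"
  define B where "B = g c \<one>\<^bsub>G\<^esub>"
  define \<beta> where "\<beta> = B (X c \<one>\<^bsub>G\<^esub>)"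
  have x: "x \<in> chart_img c" using c by (simp add: x_def)
  have px: "point_of c x = \<one>\<^bsub>G\<^esub>" unfolding x_def by (rule point_of_coords [OF c])
  have y: "\<beta> y > 0" using assms(11) by (simp add: \<beta>_def B_def)
  note bilB = bil [OF x, unfolded px, folded B_def] and symB = sym [OF x, unfolded px, folded B_def]
    and lin\<beta> = b_linear [OF x, unfolded px, folded B_def, folded \<beta>_def]
  note on = on [folded B_def]
  define \<Gamma>' where "\<Gamma>' i j k = frechet_derivative (\<lambda>z. \<Gamma> z i j k) (at x)" for i j k
  have \<Gamma>': "((\<lambda>z. \<Gamma> z i j k) has_derivative \<Gamma>' i j k) (at x)" for i j k
    using \<Gamma>_differentiable [OF x] by (simp add: \<Gamma>'_def frechet_derivative_works)
  define R where "R = curvature_form (\<Gamma> x) \<Gamma>'"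
  note curv = affine_curv_left_ext [OF c \<Gamma>' [unfolded x_def], folded x_def, folded R_def]
  have R_det: "R (p *\<^sub>R v + q *\<^sub>R y) (r *\<^sub>R v + s *\<^sub>R y) z = (p * s - q * r) *\<^sub>R R v y z" for p q r s z
    unfolding R_def by (rule curvature_form_combination) (rule has_derivative_linear [OF \<Gamma>'])
  have R_skew: "B (R v y p) q + B p (R v y q) = 0" for p q
    unfolding R_def
    by (rule curvature_form_skew [OF open_N x bil metric_derivative \<Gamma>', unfolded px, folded B_def])
  have R_lin: "linear (R v y)" unfolding R_def by (rule linear_curvature_form)
  \<comment> \<open>\<open>b_parallel\<close> needs a vector in the cone; near \<open>x\<close> the given \<open>y\<close> serves at every point.\<close>
  let ?N = "{z \<in> chart_img c. g c (point_of c z) (X c (point_of c z)) y > 0}"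
  have \<beta>_R: "\<beta> (R v y z) = 0" for z
    unfolding R_def
    by (rule parallel_covector_curvature_form [where N = ?N
          and b = "\<lambda>z. g c (point_of c z) (X c (point_of c z))",
          OF open_base _ b_linear b_parallel \<Gamma>', unfolded px, folded B_def, folded \<beta>_def])
      (use x y px in \<open>auto simp: \<beta>_def B_def\<close>)
  have sec: "sectional_curvature G g c P = B (R v y y) v"
  proof -
    define p where "p = (SOME p :: (real ^ 'n) \<times> (real ^ 'n). case p of (u, w) \<Rightarrow> span {u, w} = P)"
    obtain u w where p: "p = (u, w)" by force
    have "case p of (u, w) \<Rightarrow> span {u, w} = P"
      unfolding p_def by (rule someI [of _ "(v, y)"]) (use assms(12) in simp)
    then have "span {u, w} = span {v, y}" using assms(12) by (simp add: p)
    then obtain a b r s where uw: "u = a *\<^sub>R v + b *\<^sub>R y" "w = r *\<^sub>R v + s *\<^sub>R y" "a * s - b * r \<noteq> 0"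
      by (rule orthonormal_span_pair [OF bilB symB on])
    have "sectional_curvature G g c P = B (R u w w) u / (B u u * B w w - (B u w)\<^sup>2)"
      unfolding sectional_curvature_def p_def [symmetric] p Let_def
      by (simp add: x_def [symmetric] B_def R_def curv local_metric_def [abs_def])
    also have "\<dots> = B (R v y y) v"
      by (rule sectional_quotient [where R = R, OF bilB symB on R_det R_lin R_skew uw])
    finally show ?thesis .
  qed
  define u where "u = (SOME u. span {u, y} = P)"
  have "span {u, y} = P" unfolding u_def by (rule someI [of _ v]) fact
  then have "span {u, y} = span {v, y}" using assms(12) by simp
  then obtain a b r s where ab: "u = a *\<^sub>R v + b *\<^sub>R y" "y = r *\<^sub>R v + s *\<^sub>R y" "a * s - b * r \<noteq> 0"
    by (rule orthonormal_span_pair [OF bilB symB on])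
  have "B y y = B y (r *\<^sub>R v + s *\<^sub>R y)" "B v y = B v (r *\<^sub>R v + s *\<^sub>R y)"
    using ab(2) by (rule arg_cong [where f = "B y"], rule arg_cong [where f = "B v"])
  then have "r = 0"
    unfolding bilinear_radd [OF bilB] bilinear_rmul [OF bilB] on by simp
  then have a: "a \<noteq> 0" using ab(3) by auto
  have Ruy: "R u y y = a *\<^sub>R R v y y"
    using R_det [of a b 0 1 y] by (simp add: ab(1))
  have "riemann_op G (kropina g X) c y u = R u y y"
  proof -
    have "riemann_op G (kropina g X) c y u =
        chern_curv L (left_ext G c u) (left_ext G c y) (left_ext G c y) x y"
      unfolding riemann_op_def x_def local_finsler_def [abs_def] kropina_def ..
    also have "\<dots> = affine_curv \<Gamma> (left_ext G c u) (left_ext G c y) (left_ext G c y) x"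
      by (rule chern_curv_eq_affine_curv [OF x]) (use y px in \<open>simp add: \<beta>_def B_def\<close>)
    finally show ?thesis by (simp add: curv R_def)
  qed
  moreover have "fundamental_tensor (kropina g X c \<one>\<^bsub>G\<^esub>) y p q = kropina_tensor B \<beta> y p q" for p q
    using fundamental_tensor_kropina [OF bilB symB lin\<beta> y] by (simp add: kropina_def [abs_def] B_def \<beta>_def)
  ultimately have "flag_curvature G (kropina g X) c P y =
      kropina_tensor B \<beta> y (a *\<^sub>R R v y y) u /
      (kropina_tensor B \<beta> y y y * kropina_tensor B \<beta> y u u - (kropina_tensor B \<beta> y y u)\<^sup>2)"
    unfolding flag_curvature_def u_def [symmetric] Let_def by (simp add: Ruy)
  also have "\<dots> = 1 / ((B y y / \<beta> y) ^ 4 * (\<beta> v)\<^sup>2 + (B y y / \<beta> y)\<^sup>2) * B (R v y y) v"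
  proof (rule kropina_flag_quotient [OF bilB symB lin\<beta> y on _ \<beta>_R ab(1) a])
    show "B y (R v y y) = 0" using R_skew [of y y] symB [of y] by simp
  qed
  finally show ?thesis by (simp add: sec kropina_def B_def \<beta>_def)
qed

end
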